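(* For any integers $p\ge 1$ and $k_{1},\dots,k_{p}\ge1$, there is $n_{0}=n_{0}(k_{1},\dots,k_{p})$ such that the following holds. If $n_{1},\dots,n_{p}\ge n_{0}$ and $\mathcal{F}\subseteq\prod_{s=1}^p\binom{[n_s]}{k_s}$ is a non-trivially intersecting family, then \[ |\mathcal{F}| \le M^{\max}(n_{1},\dots,n_{p},k_{1},\dots,k_{p}):= \max M_{t,S}^{\mathrm{HM}}, \] where the maximum is over all $t\in [p]$ and $S\subseteq [p]\setminus \{t\}$, excluding the pair $(t,S)$ with $S=\emptyset$ when $k_t=1$, and excluding the pairs $(t,S)$ with $S=\{r\}$ when $k_t=k_r=1$ (for some $r$). Here, for $k_t>1$, \[ M_{t,S}^{\mathrm{HM}}:=\left(\binom{n_{t}-1}{k_{t}-1}\prod_{s\in S}\binom{n_{s}}{k_{s}}-\binom{n_{t}-k_{t}-1}{k_{t}-1}\prod_{s\in S}\binom{n_{s}-k_{s}}{k_{s}}+1\right)\prod_{s\notin S\cup\{ t\} }\binom{n_{s}}{k_{s}}, \] and for $k_t=1$, \[ M_{t,S}^{\mathrm{HM}}:=\left(\prod_{s\in S}\binom{n_{s}}{k_{s}}-\prod_{s\in S}\binom{n_{s}-k_s}{k_{s}}+(n_{t}-1)\right)\prod_{s\notin S\cup\{ t\} }\binom{n_{s}}{k_{s}}. \] (If the set of admissible pairs $(t,S)$ is empty, no non-trivially intersecting family exists and the statement holds vacuously.)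
   Context: Multi-part setting: for $p\ge1$ and positive integers $n_1,\dots,n_p$, the ground set is the disjoint union $\bigsqcup_{s=1}^p [n_s]$ of $p$ parts, where $[n]=\{1,\dots,n\}$. For $F_s\subseteq[n_s]$, $\bigsqcup_s F_s$ denotes the subset of the ground set having $F_s$ in part $s$. For $k_s\in[n_s]$, $\prod_{s}\binom{[n_s]}{k_s}$ denotes the collection of all sets $\bigsqcup_s F_s$ with $|F_s|=k_s$ for every $s$. A family $\mathcal{F}$ of such sets is intersecting if any two of its sets intersect (i.e. for any $\bigsqcup_s F_s,\bigsqcup_s G_s\in\mathcal F$ there is a part $s$ with $F_s\cap G_s\neq\emptyset$); it is trivially intersecting if some element of the ground set (a given element $i$ in a given part $s$) lies in every set of $\mathcal F$; it is non-trivially intersecting if it is intersecting but not trivially intersecting. *)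

theory Defs
  imports Main
begin

text \<open>Parts are indexed by s in {1..p}. A set of the ground set (disjoint union of
  the [n s]) is represented by a function A :: nat => nat set with A s a subset of {1..n s}
  for s in {1..p} and A s = {} outside {1..p}.\<close>

definition prod_family :: "nat \<Rightarrow> (nat \<Rightarrow> nat) \<Rightarrow> (nat \<Rightarrow> nat) \<Rightarrow> (nat \<Rightarrow> nat set) set" where
  "prod_family p n k = {A. (\<forall>s\<in>{1..p}. A s \<subseteq> {1..n s} \<and> card (A s) = k s)
                          \<and> (\<forall>s. s \<notin> {1..p} \<longrightarrow> A s = {})}"

definition intersecting :: "nat \<Rightarrow> (nat \<Rightarrow> nat set) set \<Rightarrow> bool" where
  "intersecting p \<F> = (\<forall>A\<in>\<F>. \<forall>B\<in>\<F>. \<exists>s\<in>{1..p}. A s \<inter> B s \<noteq> {})"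

definition trivially_intersecting :: "nat \<Rightarrow> (nat \<Rightarrow> nat) \<Rightarrow> (nat \<Rightarrow> nat set) set \<Rightarrow> bool" where
  "trivially_intersecting p n \<F> = (\<exists>s\<in>{1..p}. \<exists>i\<in>{1..n s}. \<forall>A\<in>\<F>. i \<in> A s)"

definition nontrivially_intersecting :: "nat \<Rightarrow> (nat \<Rightarrow> nat) \<Rightarrow> (nat \<Rightarrow> nat set) set \<Rightarrow> bool" where
  "nontrivially_intersecting p n \<F> = (intersecting p \<F> \<and> \<not> trivially_intersecting p n \<F>)"

definition M_HM :: "nat \<Rightarrow> (nat \<Rightarrow> nat) \<Rightarrow> (nat \<Rightarrow> nat) \<Rightarrow> nat \<Rightarrow> nat set \<Rightarrow> int" where
  "M_HM p n k t S =
     (if k t > 1 then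
        (int (n t - 1 choose (k t - 1)) * (\<Prod>s\<in>S. int (n s choose k s))
         - int (n t - k t - 1 choose (k t - 1)) * (\<Prod>s\<in>S. int (n s - k s choose k s)) + 1)
        * (\<Prod>s\<in>{1..p} - (S \<union> {t}). int (n s choose k s))
      else
        ((\<Prod>s\<in>S. int (n s choose k s)) - (\<Prod>s\<in>S. int (n s - k s choose k s)) + int (n t - 1))
        * (\<Prod>s\<in>{1..p} - (S \<union> {t}). int (n s choose k s)))"

definition admissible_pairs :: "nat \<Rightarrow> (nat \<Rightarrow> nat) \<Rightarrow> (nat \<times> nat set) set" where
  "admissible_pairs p k = {(t, S). t \<in> {1..p} \<and> S \<subseteq> {1..p} - {t}
       \<and> \<not> (S = {} \<and> k t = 1)
       \<and> \<not> (\<exists>r. S = {r} \<and> k t = 1 \<and> k r = 1)}"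

definition M_max :: "nat \<Rightarrow> (nat \<Rightarrow> nat) \<Rightarrow> (nat \<Rightarrow> nat) \<Rightarrow> int" where
  "M_max p n k = Max ((\<lambda>(t, S). M_HM p n k t S) ` admissible_pairs p k)"

end

theory Submission
  imports Defs Complex_Main "HOL-Library.FuncSet"
begin

text \<open>
A largest non-trivially intersecting family F contains every set that meets all its members.
Since there are no one-element covers, branching over members shows that all but a negligible
part of F contains a pair that meets every member of F; call such a pair an edge. By maximality
edges pairwise intersect, so they form a triangle or a star.

For a triangle xyz, every member contains two of x, y, z, and this family is compared with
Hilton-Milner families centred at x, y or z. For most values of k some centre wins with room to
spare; the remaining ones are settled by exact counts.

For a star with centre x and leaf set L, members avoiding x contain L. If F exceeds all
Hilton-Milner families then some edge xq has essentially the largest possible weight, and this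
makes the members avoiding x rare: comparing F with the Hilton-Milner family given by x and a
member A avoiding x, one loses a constant proportion of the sets containing x and some element
u of A outside L, which outweighs them. Only the sizes relative to each other of w {x, u} and
the number of members avoiding x matter, so the n s may be arbitrarily unbalanced.
\<close>

section \<open>Counting in a product of uniform families\<close>

text \<open>The bound \<open>M\<close> is never estimated in closed form. It enters in two ways: it
  dominates explicit families \<open>HM x B\<close>, each compared with \<open>F\<close> through the
  two set differences, and it provides a scale, being at least the weight of every valid pair
  (\<open>w_pair_le_max\<close>). The obstacle is that the parts may differ in size beyond any
  bound. Requiring one more element v divides the number of sets by about \<open>n (fst v)\<close>,
  so many elements of small parts may cost less than one element of a large part, and comparing
  numbers of elements decides nothing. Each estimate must therefore name the elements that it
  trades. An element is traded either for one in the same or a smaller part, where \<open>om\<close>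
  is at least as large, or by way of \<open>star_dominant\<close>, which turns the assumption that
  \<open>F\<close> exceeds \<open>M\<close> into a comparison across parts. One surplus element then
  pays for all constants, since its \<open>om\<close> is at most 1 / (8 K^(K + 6)).\<close>

lemma card_sections:
  assumes "finite P"
  shows "card {X. X \<subseteq> P \<times> UNIV \<and> (\<forall>s\<in>P. X `` {s} \<in> Q s)} = (\<Prod>s\<in>P. card (Q s))"
proof -
  have "bij_betw (\<lambda>f. Sigma P f) (PiE P Q) {X. X \<subseteq> P \<times> UNIV \<and> (\<forall>s\<in>P. X `` {s} \<in> Q s)}"
  proof (rule bij_betw_byWitness[where f' = "\<lambda>X. \<lambda>s\<in>P. X `` {s}"])
    show "\<forall>f\<in>PiE P Q. (\<lambda>s\<in>P. Sigma P f `` {s}) = f"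
    proof
      fix f assume f: "f \<in> PiE P Q"
      show "(\<lambda>s\<in>P. Sigma P f `` {s}) = f"
      proof (rule PiE_ext[OF _ f])
        have *: "Sigma P f `` {s} = f s" if "s \<in> P" for s using that by auto
        show "(\<lambda>s\<in>P. Sigma P f `` {s}) \<in> PiE P Q" using f * by auto
        show "(\<lambda>s\<in>P. Sigma P f `` {s}) s = f s" if "s \<in> P" for s using that * by simp
      qed
    qed
    show "\<forall>X\<in>{X. X \<subseteq> P \<times> UNIV \<and> (\<forall>s\<in>P. X `` {s} \<in> Q s)}. Sigma P (\<lambda>s\<in>P. X `` {s}) = X"
      by auto
    show "Sigma P ` PiE P Q \<subseteq> {X. X \<subseteq> P \<times> UNIV \<and> (\<forall>s\<in>P. X `` {s} \<in> Q s)}"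
    proof clarify
      fix f assume f: "f \<in> PiE P Q"
      have "Sigma P f `` {s} = f s" if "s \<in> P" for s using that by auto
      with f show "Sigma P f \<subseteq> P \<times> UNIV \<and> (\<forall>s\<in>P. Sigma P f `` {s} \<in> Q s)" by auto
    qed
    show "(\<lambda>X. \<lambda>s\<in>P. X `` {s}) ` {X. X \<subseteq> P \<times> UNIV \<and> (\<forall>s\<in>P. X `` {s} \<in> Q s)} \<subseteq> PiE P Q"
      by auto
  qed
  from bij_betw_same_card[OF this] card_PiE[OF assms, of Q] show ?thesis by simp
qed

text \<open>Every comparison with a Hilton-Milner family has this form: \<open>G - H\<close> is the
  loss and \<open>H - G\<close> the gain in passing from \<open>G\<close> to \<open>H\<close>, so it
  is enough to bound the loss from above and the gain from below.\<close>

lemma card_le_by_diff: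
  assumes "finite H" "finite G" "card (G - H) \<le> card (H - G)"
  shows "card G \<le> card H"
proof -
  have "card G = card (G \<inter> H) + card (G - H)" using assms(2) by (rule card_Int_Diff)
  moreover have "card H = card (H \<inter> G) + card (H - G)" using assms(1) by (rule card_Int_Diff)
  ultimately show ?thesis using assms(3) by (simp add: Int_commute)
qed

lemma card_subsets_between:
  assumes "finite U" "D \<subseteq> U" "D' \<subseteq> U" "D \<inter> D' = {}" "card D \<le> k"
  shows "card {S. S \<subseteq> U \<and> card S = k \<and> D \<subseteq> S \<and> S \<inter> D' = {}}
    = (card U - card D - card D') choose (k - card D)"
proof -
  have fin: "finite D" "finite D'" "finite (U - D - D')" using assms finite_subset by auto
  have "bij_betw (\<lambda>S. S \<union> D) {S. S \<subseteq> U - D - D' \<and> card S = k - card D}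
     {S. S \<subseteq> U \<and> card S = k \<and> D \<subseteq> S \<and> S \<inter> D' = {}}"
  proof (rule bij_betw_byWitness[where f' = "\<lambda>S. S - D"])
    show "(\<lambda>S. S \<union> D) ` {S. S \<subseteq> U - D - D' \<and> card S = k - card D}
      \<subseteq> {S. S \<subseteq> U \<and> card S = k \<and> D \<subseteq> S \<and> S \<inter> D' = {}}"
    proof clarify
      fix S assume S: "S \<subseteq> U - D - D'" "card S = k - card D"
      have "finite S" using S(1) fin(3) finite_subset by blast
      then have "card (S \<union> D) = card S + card D"
        using S fin by (intro card_Un_disjoint) auto
      then show "S \<union> D \<subseteq> U \<and> card (S \<union> D) = k \<and> D \<subseteq> S \<union> D \<and> (S \<union> D) \<inter> D' = {}"
        using S assms by auto
    qed
    show "(\<lambda>S. S - D) ` {S. S \<subseteq> U \<and> card S = k \<and> D \<subseteq> S \<and> S \<inter> D' = {}}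
      \<subseteq> {S. S \<subseteq> U - D - D' \<and> card S = k - card D}"
      using fin by (auto simp: card_Diff_subset)
  qed auto
  from bij_betw_same_card[OF this]
  have "card {S. S \<subseteq> U \<and> card S = k \<and> D \<subseteq> S \<and> S \<inter> D' = {}}
    = card (U - D - D') choose (k - card D)"
    using n_subsets[OF fin(3), of "k - card D"] by simp
  moreover have "card (U - D - D') = card U - card D - card D'"
  proof -
    have "D' \<subseteq> U - D" using assms by auto
    then show ?thesis using assms fin by (simp add: card_Diff_subset)
  qed
  ultimately show ?thesis by simp
qed

text \<open>
The lower bound on the n s is dictated by \<open>star_closed\<close>, which needs a factor K^K from
\<open>w_le\<close> times the square of the factor 2 K^3 from \<open>star_dominant\<close>.
\<close>

locale multipart =
  fixes p :: nat and n k :: "nat \<Rightarrow> nat" and K :: nat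
  defines "K \<equiv> \<Sum>s\<in>{1..p}. k s"
  assumes p_pos: "p \<ge> 1"
    and k_pos: "\<And>s. s \<in> {1..p} \<Longrightarrow> k s \<ge> 1"
    and n_large: "\<And>s. s \<in> {1..p} \<Longrightarrow> n s \<ge> 8 * K ^ (K + 6)"
begin

text \<open>Sets are relations here, made of pairs (part, element), unlike the functions of the
  theorem: inclusion and intersection become those of plain sets, and the component in part s is the
  relational image of {s}.\<close>

definition V :: "(nat \<times> nat) set" where
  "V = Sigma {1..p} (\<lambda>s. {1..n s})"

definition PF :: "(nat \<times> nat) set set" where
  "PF = {X. X \<subseteq> V \<and> (\<forall>s\<in>{1..p}. card (X `` {s}) = k s)}"

definition upd :: "(nat \<times> nat) set \<Rightarrow> (nat \<times> nat) set \<Rightarrow> (nat \<times> nat) set set" where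
  "upd T T' = {X \<in> PF. T \<subseteq> X \<and> X \<inter> T' = {}}"

abbreviation up :: "(nat \<times> nat) set \<Rightarrow> (nat \<times> nat) set set" where
  "up T \<equiv> upd T {}"

lemma finite_V: "finite V" by (auto simp: V_def)

lemma finite_PF: "finite PF"
  by (rule finite_subset[of _ "Pow V"]) (auto simp: PF_def finite_V)

lemma finite_upd: "finite (upd T T')"
  using finite_PF by (auto simp: upd_def)

lemma PF_subset: "X \<in> PF \<Longrightarrow> X \<subseteq> V" by (auto simp: PF_def)

lemma PF_finite: "X \<in> PF \<Longrightarrow> finite X"
  using finite_V PF_subset finite_subset by blast

lemma part_range: "v \<in> V \<Longrightarrow> fst v \<in> {1..p}" by (auto simp: V_def)

lemma card_fibres:
  assumes "X \<subseteq> V"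
  shows "card X = (\<Sum>s\<in>{1..p}. card (X `` {s}))"
proof -
  have "X = Sigma {1..p} (\<lambda>s. X `` {s})" using assms by (auto simp: V_def)
  moreover have "card (Sigma {1..p} (\<lambda>s. X `` {s})) = (\<Sum>s\<in>{1..p}. card (X `` {s}))"
  proof (rule card_SigmaI)
    show "\<forall>s\<in>{1..p}. finite (X `` {s})"
      using finite_subset[OF assms finite_V] by (simp add: finite_Image)
  qed simp
  ultimately show ?thesis by simp
qed

lemma card_PF_elem: "X \<in> PF \<Longrightarrow> card X = K"
  using card_fibres[of X] by (auto simp: PF_def K_def)

lemma k_le_K: "s \<in> {1..p} \<Longrightarrow> k s \<le> K"
  unfolding K_def by (rule member_le_sum) auto

lemma K_pos: "K \<ge> 1"
  using k_le_K[of 1] k_pos[of 1] p_pos by auto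

lemma n_ge:
  assumes "s \<in> {1..p}" "j \<le> K + 6"
  shows "8 * K ^ j \<le> n s"
proof -
  have "K ^ j \<le> K ^ (K + 6)" using K_pos assms by (intro power_increasing) auto
  with n_large[OF assms(1)] show ?thesis by linarith
qed

lemma n_ge_K: assumes "s \<in> {1..p}" shows "8 * K \<le> n s"
  using n_ge[OF assms, of 1] by simp

lemma Image_mono_card: "T \<subseteq> X \<Longrightarrow> finite X \<Longrightarrow> card (T `` {s}) \<le> card (X `` {s})"
  by (intro card_mono finite_Image) auto

text \<open>The components are chosen independently, which gives a product. The last premise guards
  against truncated subtraction: an overfull part would contribute a factor 1 instead of 0.\<close>

lemma card_upd:
  assumes "T \<subseteq> V" "T' \<subseteq> V" "T \<inter> T' = {}" "\<And>s. s \<in> {1..p} \<Longrightarrow> card (T `` {s}) \<le> k s"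
  shows "card (upd T T') = (\<Prod>s\<in>{1..p}.
    (n s - card (T `` {s}) - card (T' `` {s})) choose (k s - card (T `` {s})))"
proof -
  define Q where "Q s = {S. S \<subseteq> {1..n s} \<and> card S = k s \<and> T `` {s} \<subseteq> S \<and> S \<inter> T' `` {s} = {}}" for s
  have "upd T T' = {X. X \<subseteq> {1..p} \<times> UNIV \<and> (\<forall>s\<in>{1..p}. X `` {s} \<in> Q s)}" (is "_ = ?R")
  proof
    show "upd T T' \<subseteq> ?R" unfolding upd_def PF_def Q_def V_def by auto
    show "?R \<subseteq> upd T T'"
    proof
      fix X assume X: "X \<in> ?R"
      then have a: "\<And>s. s \<in> {1..p} \<Longrightarrow> X `` {s} \<in> Q s" and b: "fst ` X \<subseteq> {1..p}" by auto
      have "X \<subseteq> V"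
      proof
        fix v assume "v \<in> X"
        then have "fst v \<in> {1..p}" "snd v \<in> X `` {fst v}" using b by auto
        with a[of "fst v"] show "v \<in> V" unfolding Q_def V_def by (cases v) auto
      qed
      moreover have "T \<subseteq> X"
      proof
        fix v assume "v \<in> T"
        then have "v \<in> V" "snd v \<in> T `` {fst v}" using assms(1) by auto
        then have "fst v \<in> {1..p}" "snd v \<in> T `` {fst v}" using part_range by blast+
        with a[of "fst v"] have "snd v \<in> X `` {fst v}" unfolding Q_def by blast
        then show "v \<in> X" by auto
      qed
      moreover have "v \<notin> T'" if "v \<in> X" for v
      proof
        assume "v \<in> T'"
        then have "snd v \<in> X `` {fst v}" "snd v \<in> T' `` {fst v}" "fst v \<in> {1..p}" using that b by auto
        with a[of "fst v"] show False unfolding Q_def by blast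
      qed
      ultimately show "X \<in> upd T T'" using a unfolding upd_def PF_def Q_def by auto
    qed
  qed
  then have "card (upd T T') = (\<Prod>s\<in>{1..p}. card (Q s))"
    using card_sections[of "{1..p}" Q] by simp
  also have "\<dots> = (\<Prod>s\<in>{1..p}.
    (n s - card (T `` {s}) - card (T' `` {s})) choose (k s - card (T `` {s})))"
  proof (rule prod.cong[OF refl])
    fix s assume "s \<in> {1..p}"
    then show "card (Q s) = (n s - card (T `` {s}) - card (T' `` {s})) choose (k s - card (T `` {s}))"
      unfolding Q_def using assms
      by (subst card_subsets_between) (auto simp: V_def)
  qed
  finally show ?thesis .
qed

lemma fibre_card_le:
  assumes "X \<in> PF" "T \<subseteq> X" "s \<in> {1..p}"
  shows "card (T `` {s}) \<le> k s"
  using Image_mono_card[OF assms(2) PF_finite[OF assms(1)], of s] assms by (auto simp: PF_def)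

text \<open>Only one binomial factor changes, from \<open>Suc a choose Suc b\<close> to
  \<open>a choose b\<close>, and the absorption identity gives their ratio. Multiplying out keeps
  the equation in the natural numbers.\<close>

lemma card_up_insert:
  assumes "insert v T \<subseteq> X" "X \<in> PF" "v \<notin> T"
  shows "(n (fst v) - card (T `` {fst v})) * card (up (insert v T))
    = (k (fst v) - card (T `` {fst v})) * card (up T)"
proof -
  let ?s = "fst v"
  have s: "?s \<in> {1..p}" using assms part_range PF_subset by blast
  have sub: "insert v T \<subseteq> V" "T \<subseteq> V" using assms PF_subset by blast+
  have finT: "finite T" using sub finite_V finite_subset by blast
  have c1: "card (insert v T `` {?s}) = Suc (card (T `` {?s}))"
  proof -
    have "insert v T `` {?s} = insert (snd v) (T `` {?s})" by (cases v) auto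
    moreover have "snd v \<notin> T `` {?s}" using assms(3) by (cases v) auto
    ultimately show ?thesis using finT by (simp add: finite_Image)
  qed
  have c2: "card (insert v T `` {s}) = card (T `` {s})" if "s \<noteq> ?s" for s
  proof -
    have "insert v T `` {s} = T `` {s}" using that by (cases v) auto
    then show ?thesis by simp
  qed
  let ?f = "\<lambda>s. (n s - card (T `` {s})) choose (k s - card (T `` {s}))"
  let ?g = "\<lambda>s. (n s - card (insert v T `` {s})) choose (k s - card (insert v T `` {s}))"
  have A: "card (up (insert v T)) = (\<Prod>s\<in>{1..p}. ?g s)"
    using card_upd[of "insert v T" "{}"] sub fibre_card_le[OF assms(2,1)] by simp
  have B: "card (up T) = (\<Prod>s\<in>{1..p}. ?f s)"
    using card_upd[of "T" "{}"] sub fibre_card_le[OF assms(2)] assms(1) by simp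
  have R: "(\<Prod>s\<in>{1..p} - {?s}. ?g s) = (\<Prod>s\<in>{1..p} - {?s}. ?f s)"
    by (rule prod.cong) (auto simp: c2)
  have le: "Suc (card (T `` {?s})) \<le> k ?s" using fibre_card_le[OF assms(2,1) s] c1 by simp
  have kn: "k ?s \<le> n ?s" using n_ge_K[OF s] k_le_K[OF s] by linarith
  define a where "a = n ?s - Suc (card (T `` {?s}))"
  define b where "b = k ?s - Suc (card (T `` {?s}))"
  have ab: "n ?s - card (T `` {?s}) = Suc a" "k ?s - card (T `` {?s}) = Suc b"
    using le kn unfolding a_def b_def by auto
  have key: "Suc a * (a choose b) = Suc b * (Suc a choose Suc b)"
    using Suc_times_binomial_eq[of a b] by (simp only: mult.commute)
  have g: "?g ?s = a choose b" unfolding c1 a_def b_def ..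
  have f: "?f ?s = Suc a choose Suc b" unfolding ab ..
  define R where "R = (\<Prod>s\<in>{1..p} - {?s}. ?f s)"
  have "(\<Prod>s\<in>{1..p}. ?g s) = ?g ?s * (\<Prod>s\<in>{1..p} - {?s}. ?g s)"
    using s by (intro prod.remove) auto
  then have A': "card (up (insert v T)) = (a choose b) * R" unfolding A R R_def g .
  have "(\<Prod>s\<in>{1..p}. ?f s) = ?f ?s * (\<Prod>s\<in>{1..p} - {?s}. ?f s)"
    using s by (intro prod.remove) auto
  then have B': "card (up T) = (Suc a choose Suc b) * R" unfolding B R_def f .
  show ?thesis unfolding A' B' ab by (simp only: mult.assoc[symmetric] key)
qed

section \<open>Weights of sets and the effect of one more element\<close>

definition valid :: "(nat \<times> nat) set \<Rightarrow> bool" where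
  "valid T \<longleftrightarrow> (\<exists>X\<in>PF. T \<subseteq> X)"

text \<open>
\<open>om\<close> is a stand-in for the density k s / n s of an element: by \<open>w_le\<close> and \<open>w_ge\<close> the
number w T is w {} * prod om T up to a factor depending only on K, as long as T is valid.
\<close>

definition w :: "(nat \<times> nat) set \<Rightarrow> real" where
  "w T = real (card (up T))"

definition om :: "nat \<times> nat \<Rightarrow> real" where
  "om v = 1 / real (n (fst v))"

lemma validE: assumes "valid T" obtains X where "X \<in> PF" "T \<subseteq> X"
  using assms by (auto simp: valid_def)

lemma valid_subset: "valid T \<Longrightarrow> S \<subseteq> T \<Longrightarrow> valid S"
  by (auto simp: valid_def)

lemma valid_V: "valid T \<Longrightarrow> T \<subseteq> V"
  by (auto simp: valid_def dest: PF_subset)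

lemma valid_finite: "valid T \<Longrightarrow> finite T"
  using valid_V finite_V finite_subset by blast

lemma valid_card: assumes "valid T" shows "card T \<le> K"
proof -
  obtain X where "X \<in> PF" "T \<subseteq> X" using assms by (rule validE)
  then show ?thesis using card_mono[OF PF_finite, of X T] card_PF_elem[of X] by simp
qed

lemma w_nonneg [simp]: "0 \<le> w T" by (simp add: w_def)

lemma w_invalid: "\<not> valid T \<Longrightarrow> w T = 0"
proof -
  assume "\<not> valid T"
  then have "up T = {}" by (auto simp: valid_def upd_def)
  then show ?thesis by (simp add: w_def)
qed

lemma n_pos: assumes "v \<in> V" shows "real (n (fst v)) > 0"
  using n_ge_K[OF part_range[OF assms]] K_pos by linarith

lemma om_pos: "v \<in> V \<Longrightarrow> om v > 0"
  using n_pos by (simp add: om_def)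

lemma om_nonneg: "v \<in> V \<Longrightarrow> om v \<ge> 0"
  using om_pos by (simp add: less_imp_le)

lemma om_le:
  assumes "v \<in> V" "j \<le> K + 6"
  shows "8 * real K ^ j * om v \<le> 1"
proof -
  have "real (8 * K ^ j) \<le> real (n (fst v))"
    using n_ge[OF part_range[OF assms(1)] assms(2)] by (simp only: of_nat_le_iff)
  then show ?thesis using n_pos[OF assms(1)] by (simp add: om_def)
qed

lemma om_le_1: "v \<in> V \<Longrightarrow> om v \<le> 1"
  using om_le[of v 0] om_pos[of v] by simp

text \<open>At most K elements are forbidden while every part has at least 8 K, so each component
  can still be completed.\<close>

lemma exists_avoiding:
  assumes "T \<subseteq> V" "\<And>s. s \<in> {1..p} \<Longrightarrow> card (T `` {s}) \<le> k s"
    and "T' \<subseteq> V" "T \<inter> T' = {}" "card T' \<le> K"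
  shows "\<exists>X\<in>PF. T \<subseteq> X \<and> X \<inter> T' = {}"
proof -
  have finT': "finite T'" using assms finite_V finite_subset by blast
  have "card (upd T T') > 0"
  proof (subst card_upd[OF assms(1,3,4,2)], assumption, rule prod_pos)
    fix s assume s: "s \<in> {1..p}"
    have "card (T' `` {s}) \<le> card T'"
    proof -
      have "T' `` {s} \<subseteq> snd ` T'" by force
      then have "card (T' `` {s}) \<le> card (snd ` T')" using finT' by (intro card_mono) auto
      also have "\<dots> \<le> card T'" using finT' by (rule card_image_le)
      finally show ?thesis .
    qed
    then have "k s - card (T `` {s}) \<le> n s - card (T `` {s}) - card (T' `` {s})"
      using n_ge_K[OF s] k_le_K[OF s] assms(5) by linarith
    then show "0 < (n s - card (T `` {s}) - card (T' `` {s})) choose (k s - card (T `` {s}))"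
      by (simp add: zero_less_binomial_iff)
  qed
  then have "upd T T' \<noteq> {}" by force
  then show ?thesis by (auto simp: upd_def)
qed

lemma valid_avoiding:
  assumes "valid T" "T' \<subseteq> V" "T \<inter> T' = {}" "card T' \<le> K"
  shows "\<exists>X\<in>PF. T \<subseteq> X \<and> X \<inter> T' = {}"
proof (rule exists_avoiding[OF valid_V[OF assms(1)] _ assms(2-4)])
  fix s assume "s \<in> {1..p}"
  then show "card (T `` {s}) \<le> k s"
    using assms(1) fibre_card_le by (auto elim: validE)
qed

lemma valid_iff:
  assumes "T \<subseteq> V"
  shows "valid T \<longleftrightarrow> (\<forall>s\<in>{1..p}. card (T `` {s}) \<le> k s)"
proof
  assume "valid T"
  then show "\<forall>s\<in>{1..p}. card (T `` {s}) \<le> k s" using fibre_card_le by (auto elim: validE)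
next
  assume "\<forall>s\<in>{1..p}. card (T `` {s}) \<le> k s"
  then show "valid T" using exists_avoiding[OF assms, of "{}"] by (auto simp: valid_def)
qed

lemma w_empty_pos: "w {} > 0"
proof -
  have "\<exists>X\<in>PF. {} \<subseteq> X \<and> X \<inter> {} = {}" by (rule exists_avoiding) auto
  then have "up {} \<noteq> {}" by (auto simp: upd_def)
  then show ?thesis using finite_upd by (simp add: w_def card_gt_0_iff)
qed

lemma w_insert_eq:
  assumes "valid (insert v T)" "v \<notin> T"
  shows "(real (n (fst v)) - card (T `` {fst v})) * w (insert v T) = (real (k (fst v)) - card (T `` {fst v})) * w T"
    and "card (T `` {fst v}) < k (fst v)" "k (fst v) \<le> n (fst v)"
proof -
  obtain X where X: "X \<in> PF" "insert v T \<subseteq> X" using assms(1) by (rule validE)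
  have s: "fst v \<in> {1..p}" using X PF_subset part_range by blast
  have fin: "finite T" using valid_finite[OF assms(1)] by simp
  have "insert v T `` {fst v} = insert (snd v) (T `` {fst v})" by (cases v) auto
  moreover have "snd v \<notin> T `` {fst v}" using assms(2) by (cases v) auto
  ultimately have "card (insert v T `` {fst v}) = Suc (card (T `` {fst v}))"
    using fin by (simp add: finite_Image)
  then show lt: "card (T `` {fst v}) < k (fst v)" using fibre_card_le[OF X s] by simp
  show kn: "k (fst v) \<le> n (fst v)" using n_ge_K[OF s] k_le_K[OF s] by linarith
  have "real ((n (fst v) - card (T `` {fst v})) * card (up (insert v T)))
    = real ((k (fst v) - card (T `` {fst v})) * card (up T))"
    using card_up_insert[OF X(2,1) assms(2)] by (simp only:)
  then show "(real (n (fst v)) - card (T `` {fst v})) * w (insert v T) = (real (k (fst v)) - card (T `` {fst v})) * w T"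
    using lt kn by (simp add: w_def of_nat_diff)
qed

lemma w_insert_le:
  assumes "v \<in> V" "v \<notin> T"
  shows "w (insert v T) \<le> K * om v * w T"
proof (cases "valid (insert v T)")
  case True
  let ?n = "real (n (fst v))" and ?k = "real (k (fst v))" and ?j = "real (card (T `` {fst v}))"
  note eq = w_insert_eq[OF True assms(2)]
  have pos: "?n - ?j > 0" using eq(2,3) by simp
  \<comment> \<open>The exact ratio (k - j) / (n - j) is at most k / n because k is at most
    n.\<close>
  have "?n * (?k - ?j) \<le> ?k * (?n - ?j)" using eq(3) by (simp add: algebra_simps mult_right_mono)
  then have "?n * (?k - ?j) * w T \<le> ?k * (?n - ?j) * w T" by (intro mult_right_mono) auto
  moreover have "(?n - ?j) * (?n * w (insert v T)) = ?n * ((?n - ?j) * w (insert v T))"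
    by (rule mult.left_commute)
  ultimately have "(?n - ?j) * (?n * w (insert v T)) \<le> (?n - ?j) * (?k * w T)"
    unfolding eq(1) by (simp only: mult_ac)
  then have "?n * w (insert v T) \<le> ?k * w T" using pos by (simp add: mult_le_cancel_left)
  also have "\<dots> \<le> K * w T"
    using k_le_K[OF part_range[OF assms(1)]] by (intro mult_right_mono) auto
  finally show ?thesis using n_pos[OF assms(1)] by (simp add: om_def field_simps)
next
  case False
  then show ?thesis using om_pos[OF assms(1)] by (simp add: w_invalid)
qed

text \<open>Validity leaves a free place in the part of v, so the exact ratio (k - j) / (n - j) is
  at least 1 / n.\<close>

lemma w_insert_ge:
  assumes "valid (insert v T)" "v \<notin> T"
  shows "w T * om v \<le> w (insert v T)"
proof -
  let ?n = "real (n (fst v))" and ?k = "real (k (fst v))" and ?j = "real (card (T `` {fst v}))"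
  note eq = w_insert_eq[OF assms]
  have v: "v \<in> V" using valid_V[OF assms(1)] by auto
  have "1 * w T \<le> (?k - ?j) * w T" using eq(2) by (intro mult_right_mono) auto
  also have "\<dots> = (?n - ?j) * w (insert v T)" using eq(1) by simp
  also have "\<dots> \<le> ?n * w (insert v T)" by (intro mult_right_mono) auto
  finally show ?thesis using n_pos[OF v] by (simp add: om_def field_simps)
qed

lemma w_le:
  assumes "finite T" "T \<subseteq> V"
  shows "w T \<le> w {} * real K ^ card T * prod om T"
  using assms
proof (induction T)
  case (insert v T)
  have "w (insert v T) \<le> K * om v * w T" using insert by (intro w_insert_le) auto
  also have "\<dots> \<le> K * om v * (w {} * real K ^ card T * prod om T)"
    using insert om_pos[of v] by (intro mult_left_mono) auto
  finally show ?case using insert by (simp add: mult_ac)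
qed simp

lemma w_ge:
  assumes "finite T" "valid T"
  shows "w {} * prod om T \<le> w T"
  using assms
proof (induction T)
  case (insert v T)
  have vT: "valid T" using insert valid_subset by blast
  have "v \<in> V" using insert valid_V by blast
  then have "w {} * prod om T * om v \<le> w T * om v"
    using insert vT om_pos[of v] by (intro mult_right_mono) auto
  also have "\<dots> \<le> w (insert v T)" using insert by (intro w_insert_ge) auto
  finally show ?case using insert by (simp add: mult_ac)
qed simp

lemma om_prod_mono:
  assumes "finite T" "S \<subseteq> T" "T \<subseteq> V"
  shows "prod om T \<le> prod om S"
proof -
  have "prod om T = prod om (T - S) * prod om S" using assms by (intro prod.subset_diff) auto
  also have "\<dots> \<le> 1 * prod om S"
    using assms by (intro mult_right_mono prod_le_1 prod_nonneg) (auto intro: om_nonneg om_le_1)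
  finally show ?thesis by simp
qed

lemma card_meeting_le:
  assumes "G \<subseteq> up T" "finite C" "\<And>X. X \<in> G \<Longrightarrow> X \<inter> C \<noteq> {}"
  shows "real (card G) \<le> (\<Sum>v\<in>C. w (insert v T))"
proof -
  have "G \<subseteq> (\<Union>v\<in>C. up (insert v T))" using assms by (fastforce simp: upd_def)
  then have "card G \<le> card (\<Union>v\<in>C. up (insert v T))"
    using assms(2) finite_upd by (intro card_mono) auto
  also have "\<dots> \<le> (\<Sum>v\<in>C. card (up (insert v T)))" using assms(2) by (rule card_UN_le)
  finally have "real (card G) \<le> real (\<Sum>v\<in>C. card (up (insert v T)))" by (simp only: of_nat_le_iff)
  then show ?thesis by (simp add: w_def)
qed

text \<open>Each element v of \<open>C\<close> costs a factor K * om v, at most 1 / (8 K^(j + 1)),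
  and there are at most K of them. The main use: \<open>G\<close> consists of members of
  \<open>F\<close> containing \<open>T\<close>, and \<open>C\<close> is a member missing
  \<open>T\<close>. Thus a set that some member misses lies in few members, measured against
  \<open>w T\<close>.\<close>

lemma card_meeting_small:
  assumes "G \<subseteq> up T" "C \<subseteq> V" "card C \<le> K" "C \<inter> T = {}" "\<And>X. X \<in> G \<Longrightarrow> X \<inter> C \<noteq> {}"
    and "j \<le> K + 4"
  shows "8 * real K ^ j * real (card G) \<le> w T"
proof -
  have finC: "finite C" using assms(2) finite_V finite_subset by blast
  have "real (card G) \<le> (\<Sum>v\<in>C. w (insert v T))"
    using assms(1) finC assms(5) by (rule card_meeting_le)
  also have "\<dots> \<le> (\<Sum>v\<in>C. K * om v * w T)"
    using assms by (intro sum_mono w_insert_le) auto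
  finally have "real (card G) * (8 * real K ^ (j + 2)) \<le> (\<Sum>v\<in>C. K * om v * w T) * (8 * real K ^ (j + 2))"
    by (intro mult_right_mono) auto
  also have "\<dots> = (\<Sum>v\<in>C. (8 * real K ^ (j + 2) * om v) * (K * w T))"
    unfolding sum_distrib_right by (rule sum.cong) (simp_all add: mult_ac)
  also have "\<dots> \<le> (\<Sum>v\<in>C. 1 * (K * w T))"
    using assms(2,6) by (intro sum_mono mult_right_mono om_le) auto
  also have "\<dots> = card C * (K * w T)" by simp
  also have "\<dots> \<le> K * (K * w T)" using assms(3) by (intro mult_right_mono) auto
  finally have "real K ^ 2 * (8 * real K ^ j * real (card G)) \<le> real K ^ 2 * w T"
    by (simp add: power2_eq_square mult_ac)
  then show ?thesis using K_pos by (simp add: mult_le_cancel_left)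
qed

text \<open>The sets that meet \<open>T'\<close> form at most an eighth of \<open>up T\<close>; this
  is the source of the factors 7 and 8 in later comparisons.\<close>

lemma card_upd_ge:
  assumes "T' \<subseteq> V" "card T' \<le> K" "T' \<inter> T = {}"
  shows "7 * w T \<le> 8 * real (card (upd T T'))"
proof -
  have "8 * real K ^ 0 * real (card (up T - upd T T')) \<le> w T"
    by (rule card_meeting_small[of _ T T']) (use assms in \<open>auto simp: upd_def\<close>)
  moreover have "card (up T - upd T T') = card (up T) - card (upd T T')"
    by (intro card_Diff_subset finite_upd) (auto simp: upd_def)
  moreover have "card (upd T T') \<le> card (up T)"
    by (intro card_mono finite_upd) (auto simp: upd_def)
  ultimately show ?thesis by (simp add: w_def of_nat_diff)
qed

section \<open>Exact weights of pairs\<close>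

lemma w_pair_diff:
  assumes "a \<in> V" "b \<in> V" "fst a \<noteq> fst b"
  shows "w {a, b} = w {} * (k (fst a) / n (fst a)) * (k (fst b) / n (fst b))"
    and "valid {a, b}"
proof -
  obtain s i t j where ab: "a = (s, i)" "b = (t, j)" by (cases a, cases b)
  have st: "s \<in> {1..p}" "t \<in> {1..p}" "s \<noteq> t" using assms part_range ab by force+
  have im: "{a, b} `` {r} = (if r = s then {i} else if r = t then {j} else {})" for r
    using st(3) unfolding ab by auto
  show v: "valid {a, b}"
    using assms k_pos by (subst valid_iff) (auto simp: im)
  then have va: "valid {a}" by (rule valid_subset) auto
  have "{(s, i)} `` {t} = {}" using st(3) by auto
  then have 1: "real (n t) * w {b, a} = real (k t) * w {a}"
    using w_insert_eq(1)[of b "{a}"] v st(3) by (auto simp: ab insert_commute)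
  have 2: "real (n s) * w {a} = real (k s) * w {}"
    using w_insert_eq(1)[of a "{}"] va by (auto simp: ab)
  show "w {a, b} = w {} * (k (fst a) / n (fst a)) * (k (fst b) / n (fst b))"
    using 1 2 n_pos[OF assms(1)] n_pos[OF assms(2)]
    by (simp add: ab insert_commute field_simps)
qed

lemma w_pair_same:
  assumes "a \<in> V" "b \<in> V" "a \<noteq> b" "fst a = s" "fst b = s" "k s \<ge> 2"
  shows "w {a, b} = w {} * (k s / n s) * ((real (k s) - 1) / (real (n s) - 1))"
    and "valid {a, b}"
proof -
  obtain i j where ab: "a = (s, i)" "b = (s, j)" "i \<noteq> j" using assms by (cases a, cases b) auto
  have st: "s \<in> {1..p}" using assms(4) part_range[OF assms(1)] by simp
  have im: "{a, b} `` {r} = (if r = s then {i, j} else {})" for r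
    unfolding ab by auto
  show v: "valid {a, b}"
    using assms by (subst valid_iff) (auto simp: im ab(3))
  then have va: "valid {a}" by (rule valid_subset) auto
  have "{(s, i)} `` {s} = {i}" by auto
  then have 1: "(real (n s) - 1) * w {b, a} = (real (k s) - 1) * w {a}"
    using w_insert_eq(1)[of b "{a}"] v ab(3) by (auto simp: ab insert_commute)
  have 2: "real (n s) * w {a} = real (k s) * w {}"
    using w_insert_eq(1)[of a "{}"] va by (auto simp: ab)
  have 3: "real (n s) - 1 > 0" using n_ge_K[OF st] k_le_K[OF st] assms(6) by linarith
  have "w {b, a} = (real (k s) - 1) * w {a} / (real (n s) - 1)"
    by (subst eq_divide_eq) (use 1 3 in \<open>auto simp: mult.commute\<close>)
  moreover have "w {a} = real (k s) * w {} / real (n s)"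
    by (subst eq_divide_eq) (use 2 3 in \<open>auto simp: mult.commute\<close>)
  ultimately show "w {a, b} = w {} * (k s / n s) * ((real (k s) - 1) / (real (n s) - 1))"
    by (simp add: insert_commute)
qed

section \<open>Hilton-Milner families\<close>

text \<open>In all uses \<open>B\<close> consists of the elements that a set avoiding x has in
  chosen parts. The part of x and the other chosen parts are the t and S of the theorem.\<close>

definition HM :: "nat \<times> nat \<Rightarrow> (nat \<times> nat) set \<Rightarrow> (nat \<times> nat) set set" where
  "HM x B = {X \<in> PF. x \<in> X \<and> X \<inter> B \<noteq> {}} \<union> {X \<in> PF. x \<notin> X \<and> B \<subseteq> X}"

lemma finite_HM: "finite (HM x B)"
  by (rule finite_subset[OF _ finite_PF]) (auto simp: HM_def)

lemma Image_restrict_part: "{v \<in> A. fst v \<in> Q} `` {s} = (if s \<in> Q then A `` {s} else {})"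
  by auto

lemma card_restrict_part:
  assumes "A \<in> PF" "Q \<subseteq> {1..p}"
  shows "card {v \<in> A. fst v \<in> Q} = (\<Sum>s\<in>Q. k s)"
proof -
  have "card {v \<in> A. fst v \<in> Q} = (\<Sum>s\<in>{1..p}. card ({v \<in> A. fst v \<in> Q} `` {s}))"
    using PF_subset[OF assms(1)] by (intro card_fibres) auto
  also have "\<dots> = (\<Sum>s\<in>{1..p}. if s \<in> Q then k s else 0)"
    unfolding Image_restrict_part using assms(1) by (intro sum.cong) (auto simp: PF_def)
  also have "\<dots> = (\<Sum>s\<in>{1..p} \<inter> Q. k s)" by (simp add: sum.inter_restrict)
  also have "{1..p} \<inter> Q = Q" using assms(2) by auto
  finally show ?thesis .
qed

lemma finite_admissible: "finite (admissible_pairs p k)"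
  by (rule finite_subset[of _ "{1..p} \<times> Pow {1..p}"]) (auto simp: admissible_pairs_def)

lemma M_HM_le_max:
  assumes "(t, S) \<in> admissible_pairs p k"
  shows "M_HM p n k t S \<le> M_max p n k"
  unfolding M_max_def using assms finite_admissible by (intro Max_ge) force+

text \<open>The condition on \<open>fst x\<close> unites the two cases of \<open>M_HM\<close>. If
  \<open>k t > 1\<close>, then \<open>B\<close> fills part t with k t elements, which sets through x
  missing \<open>B\<close> must avoid, and sets containing \<open>B\<close> have no choice left
  there. If \<open>k t = 1\<close>, a set through x has nothing else in part t, so \<open>B\<close>
  stays out of it, and a set containing \<open>B\<close> but not x has n t - 1 choices
  there.\<close>

lemma card_HM:
  assumes "x \<in> V" "A \<in> PF" "x \<notin> A" "Q \<subseteq> {1..p}" "fst x \<in> Q \<longleftrightarrow> k (fst x) > 1"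
  shows "int (card (HM x {v \<in> A. fst v \<in> Q})) = M_HM p n k (fst x) (Q - {fst x})"
proof -
  define B where "B = {v \<in> A. fst v \<in> Q}"
  define t where "t = fst x"
  define S where "S = Q - {t}"
  define R where "R = {1..p} - (S \<union> {t})"
  have t: "t \<in> {1..p}" using part_range[OF assms(1)] by (simp add: t_def)
  have split: "(\<Prod>s\<in>{1..p}. f s) = f t * (\<Prod>s\<in>S. f s) * (\<Prod>s\<in>R. f s)" for f :: "nat \<Rightarrow> int"
  proof -
    have "{1..p} = insert t (S \<union> R)" using t assms(4) by (auto simp: S_def R_def)
    moreover have "finite S" "finite R" "t \<notin> S \<union> R" "S \<inter> R = {}"
      using assms(4) finite_subset[of Q "{1..p}"] by (auto simp: S_def R_def)
    ultimately show ?thesis by (simp add: prod.union_disjoint mult.assoc)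
  qed
  have BV: "B \<subseteq> V" "{x} \<subseteq> V" "x \<notin> B" using assms PF_subset by (auto simp: B_def)
  have kA: "card (A `` {s}) = k s" if "s \<in> {1..p}" for s using assms(2) that by (auto simp: PF_def)
  have imx: "card ({x} `` {s}) = (if s = t then 1 else 0)" for s
  proof -
    have "{x} `` {s} = (if s = t then {snd x} else {})" by (cases x) (auto simp: t_def)
    then show ?thesis by simp
  qed
  have imB: "card (B `` {s}) = (if s \<in> Q then k s else 0)" if "s \<in> {1..p}" for s
    unfolding B_def Image_restrict_part using kA[OF that] by simp
  have S: "s \<in> {1..p}" "s \<noteq> t" "s \<in> Q" if "s \<in> S" for s using that assms(4) by (auto simp: S_def)
  have R: "s \<in> {1..p}" "s \<noteq> t" "s \<notin> Q" if "s \<in> R" for s using that by (auto simp: S_def R_def)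
  have kt: "k t \<ge> 1" using k_pos t by auto
  have u: "int (card (up {x})) = int (n t - 1 choose (k t - 1)) * (\<Prod>s\<in>S. int (n s choose k s))
      * (\<Prod>s\<in>R. int (n s choose k s))"
  proof -
    have "card (up {x}) = (\<Prod>s\<in>{1..p}. (n s - card ({x} `` {s})) choose (k s - card ({x} `` {s})))"
      using BV k_pos card_upd[of "{x}" "{}"] by (simp add: imx)
    then have "int (card (up {x})) = (\<Prod>s\<in>{1..p}. int ((n s - card ({x} `` {s})) choose (k s - card ({x} `` {s}))))"
      by simp
    also have "\<dots> = int (n t - 1 choose (k t - 1)) * (\<Prod>s\<in>S. int (n s choose k s)) * (\<Prod>s\<in>R. int (n s choose k s))"
      unfolding split using S R by (simp add: imx)
    finally show ?thesis .
  qed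
  have v: "int (card (upd {x} B)) = int (n t - 1 - (if k t > 1 then k t else 0) choose (k t - 1))
      * (\<Prod>s\<in>S. int (n s - k s choose k s)) * (\<Prod>s\<in>R. int (n s choose k s))"
  proof -
    have "card (upd {x} B) = (\<Prod>s\<in>{1..p}. (n s - card ({x} `` {s}) - card (B `` {s})) choose (k s - card ({x} `` {s})))"
      using BV k_pos by (intro card_upd) (auto simp: imx)
    then have "int (card (upd {x} B)) = (\<Prod>s\<in>{1..p}. int ((n s - card ({x} `` {s}) - card (B `` {s})) choose (k s - card ({x} `` {s}))))"
      by simp
    also have "\<dots> = int (n t - 1 - (if k t > 1 then k t else 0) choose (k t - 1))
      * (\<Prod>s\<in>S. int (n s - k s choose k s)) * (\<Prod>s\<in>R. int (n s choose k s))"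
      unfolding split using S R t assms(5) by (simp add: imx imB t_def[symmetric])
    finally show ?thesis .
  qed
  have y: "int (card (upd B {x})) = (if k t > 1 then 1 else int (n t - 1)) * (\<Prod>s\<in>R. int (n s choose k s))"
  proof -
    have "card (upd B {x}) = (\<Prod>s\<in>{1..p}. (n s - card (B `` {s}) - card ({x} `` {s})) choose (k s - card (B `` {s})))"
      using BV by (intro card_upd) (auto simp: imB)
    then have "int (card (upd B {x})) = (\<Prod>s\<in>{1..p}. int ((n s - card (B `` {s}) - card ({x} `` {s})) choose (k s - card (B `` {s}))))"
      by simp
    also have "\<dots> = (if k t > 1 then 1 else int (n t - 1)) * (\<Prod>s\<in>R. int (n s choose k s))"
      unfolding split using S R t assms(5) kt
      by (cases "k t > 1") (auto simp: imx imB t_def[symmetric] le_Suc_eq not_less)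
    finally show ?thesis .
  qed
  have dec: "HM x B = (up {x} - upd {x} B) \<union> upd B {x}"
    by (auto simp: HM_def upd_def)
  have "card (HM x B) = card (up {x} - upd {x} B) + card (upd B {x})"
    unfolding dec by (intro card_Un_disjoint finite_Diff finite_upd) (auto simp: upd_def)
  moreover have "card (up {x} - upd {x} B) = card (up {x}) - card (upd {x} B)"
    by (intro card_Diff_subset finite_upd) (auto simp: upd_def)
  moreover have "card (upd {x} B) \<le> card (up {x})"
    by (intro card_mono finite_upd) (auto simp: upd_def)
  ultimately have c: "int (card (HM x B)) = int (card (up {x})) - int (card (upd {x} B)) + int (card (upd B {x}))"
    by simp
  have "int (card (HM x B)) = M_HM p n k t S"
  proof (cases "k t > 1")
    case True
    have "n t - 1 - k t = n t - k t - 1" by simp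
    with c True show ?thesis
      unfolding u v y M_HM_def R_def[symmetric] by (simp only: if_True) (simp add: algebra_simps)
  next
    case False
    then have "k t - 1 = 0" using kt by simp
    with c False show ?thesis
      unfolding u v y M_HM_def R_def[symmetric] by (simp only: if_False) (simp add: algebra_simps)
  qed
  then show ?thesis by (simp add: B_def S_def t_def)
qed

text \<open>The two excluded kinds of pairs (t, S) are those for which \<open>B\<close> would be
  empty or a single element.\<close>

lemma card_HM_le_max:
  assumes "x \<in> V" "A \<in> PF" "x \<notin> A" "Q \<subseteq> {1..p}" "fst x \<in> Q \<longleftrightarrow> k (fst x) > 1"
    and "card {v \<in> A. fst v \<in> Q} \<ge> 2"
  shows "int (card (HM x {v \<in> A. fst v \<in> Q})) \<le> M_max p n k"
proof -
  have s: "(\<Sum>s\<in>Q. k s) \<ge> 2" using card_restrict_part[OF assms(2,4)] assms(6) by simp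
  have "Q - {fst x} \<noteq> {}" if "k (fst x) = 1"
    using s assms(5) that by (cases "Q = {}") auto
  moreover have "k r \<noteq> 1" if "Q - {fst x} = {r}" "k (fst x) = 1" for r
  proof -
    have "Q = {r}" using that assms(5) by auto
    with s show ?thesis by simp
  qed
  ultimately have "(fst x, Q - {fst x}) \<in> admissible_pairs p k"
    using part_range[OF assms(1)] assms(4) by (auto simp: admissible_pairs_def)
  from M_HM_le_max[OF this] card_HM[OF assms(1-5)] show ?thesis by simp
qed

lemma same_part_k:
  assumes "valid {a, b}" "a \<noteq> b" "fst a = fst b"
  shows "k (fst a) > 1"
proof -
  obtain s i j where ab: "a = (s, i)" "b = (s, j)" "i \<noteq> j" using assms by (cases a, cases b) auto
  have "{a, b} \<subseteq> V" using valid_V[OF assms(1)] .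
  then have "s \<in> {1..p}" using part_range ab by force
  then have "card ({a, b} `` {s}) \<le> k s" using valid_iff[OF \<open>{a, b} \<subseteq> V\<close>] assms(1) by blast
  moreover have "{a, b} `` {s} = {i, j}" using ab by auto
  ultimately show ?thesis using ab by simp
qed

lemma valid_pairI:
  assumes "a \<in> V" "b \<in> V" "a \<noteq> b" "fst a = fst b \<Longrightarrow> k (fst a) > 1"
  shows "valid {a, b}"
proof (cases "fst a = fst b")
  case True
  then show ?thesis
    using w_pair_same(2)[OF assms(1-3) refl True[symmetric]] assms(4)[OF True] by linarith
qed (rule w_pair_diff(2)[OF assms(1,2)])

text \<open>The parts in which a set through an element of part t can have further elements. If
  \<open>B\<close> is the trace on them of a member avoiding x, every member through x meets
  \<open>B\<close>.\<close>

definition parts_off :: "nat \<Rightarrow> nat set" where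
  "parts_off t = (if k t > 1 then {1..p} else {1..p} - {t})"

definition two_of :: "nat \<times> nat \<Rightarrow> nat \<times> nat \<Rightarrow> nat \<times> nat \<Rightarrow> (nat \<times> nat) set set" where
  "two_of x y z = {X \<in> PF. x \<in> X \<and> y \<in> X \<or> x \<in> X \<and> z \<in> X \<or> y \<in> X \<and> z \<in> X}"

lemma finite_two_of: "finite (two_of x y z)"
  by (rule finite_subset[OF _ finite_PF]) (auto simp: two_of_def)

end

section \<open>The structure of large families\<close>

locale intersecting_family = multipart +
  fixes F :: "(nat \<times> nat) set set"
  assumes F_sub: "F \<subseteq> PF"
    and meet: "\<And>A B. A \<in> F \<Longrightarrow> B \<in> F \<Longrightarrow> A \<inter> B \<noteq> {}"
    and nontriv: "\<And>v. v \<in> V \<Longrightarrow> \<exists>A\<in>F. v \<notin> A"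
    and maximal: "\<And>X. X \<in> PF \<Longrightarrow> (\<And>A. A \<in> F \<Longrightarrow> X \<inter> A \<noteq> {}) \<Longrightarrow> X \<in> F"
begin

section \<open>Edges and the members that contain none\<close>

definition edge :: "nat \<times> nat \<Rightarrow> nat \<times> nat \<Rightarrow> bool" where
  "edge a b \<longleftrightarrow> a \<noteq> b \<and> valid {a, b} \<and> (\<forall>A\<in>F. a \<in> A \<or> b \<in> A)"

abbreviation M :: int where "M \<equiv> M_max p n k"

lemma finite_F: "finite F" by (rule finite_subset[OF F_sub finite_PF])

lemma F_V: "A \<in> F \<Longrightarrow> A \<subseteq> V" using F_sub PF_subset by blast

lemma F_finite: "A \<in> F \<Longrightarrow> finite A" using F_sub PF_finite by blast

lemma F_card: "A \<in> F \<Longrightarrow> card A = K" using F_sub card_PF_elem by blast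

lemma F_valid: "A \<in> F \<Longrightarrow> T \<subseteq> A \<Longrightarrow> valid T" using F_sub by (auto simp: valid_def)

lemma V_nonempty: "(1, 1) \<in> V"
proof -
  have "1 \<in> {1..p}" using p_pos by simp
  then show ?thesis using n_ge_K[of 1] K_pos by (simp add: V_def)
qed

lemma F_nonempty: "F \<noteq> {}" using nontriv[OF V_nonempty] by blast

lemma edge_commute: "edge a b \<longleftrightarrow> edge b a"
  by (auto simp: edge_def insert_commute)

text \<open>Otherwise some set contains {a, b} and avoids {c, d}. It meets every member because {a,
  b} does, so it belongs to \<open>F\<close> by \<open>maximal\<close>, and yet it misses the edge c
  d.\<close>

lemma edges_meet:
  assumes "edge a b" "edge c d"
  shows "{a, b} \<inter> {c, d} \<noteq> {}"
proof
  assume dis: "{a, b} \<inter> {c, d} = {}"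
  have "valid {a, b}" "valid {c, d}" using assms by (simp_all add: edge_def)
  then have "\<exists>X\<in>PF. {a, b} \<subseteq> X \<and> X \<inter> {c, d} = {}"
    using valid_avoiding[OF _ valid_V dis valid_card] by simp
  then obtain X where X: "X \<in> PF" "{a, b} \<subseteq> X" "X \<inter> {c, d} = {}" by blast
  have "X \<in> F" using X assms(1) unfolding edge_def by (intro maximal) blast+
  then show False using X assms(2) unfolding edge_def by blast
qed

text \<open>This secures an admissible pair with centre in part t. If K were at most 2, two members
  sharing only b would have different elements in part t, and a member avoiding b would have to
  contain both of these.\<close>

lemma K_ge_3:
  assumes "t \<in> {1..p}" "k t = 1"
  shows "K \<ge> 3"
proof (rule ccontr)
  assume "\<not> K \<ge> 3"
  then have two: "card A \<le> 2" "finite A" if "A \<in> F" for A using F_card F_finite that by auto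
  have elt: "\<exists>a\<in>A. fst a = t" if "A \<in> F" for A
  proof -
    have "card (A `` {t}) = 1" using F_sub that assms by (auto simp: PF_def)
    then obtain i where "A `` {t} = {i}" by (auto simp: card_1_singleton_iff)
    then have "(t, i) \<in> A" by auto
    then show ?thesis by force
  qed
  have uniq: "a = b" if "A \<in> F" "a \<in> A" "b \<in> A" "fst a = t" "fst b = t" for A a b
    using same_part_k[of a b] F_valid[OF that(1), of "{a, b}"] that assms(2) by auto
  obtain A where A: "A \<in> F" using F_nonempty by blast
  obtain a where a: "a \<in> A" "fst a = t" using elt[OF A] by blast
  obtain A1 where A1: "A1 \<in> F" "a \<notin> A1" using nontriv a F_V[OF A] by blast
  obtain b where b: "b \<in> A" "b \<in> A1" using meet[OF A A1(1)] by blast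
  obtain a1 where a1: "a1 \<in> A1" "fst a1 = t" using elt[OF A1(1)] by blast
  have ab: "a \<noteq> b" using b A1 by auto
  then have "fst b \<noteq> t" using uniq[OF A a(1) b(1) a(2)] by blast
  then have a1b: "a1 \<noteq> b" using a1 by auto
  have A': "A = {a, b}" using two[OF A] a b ab by (intro card_seteq[symmetric]) auto
  have A1': "A1 = {a1, b}" using two[OF A1(1)] a1 b a1b by (intro card_seteq[symmetric]) auto
  obtain A2 where A2: "A2 \<in> F" "b \<notin> A2" using nontriv b F_V[OF A] by blast
  have "a \<in> A2" "a1 \<in> A2" using meet[OF A2(1) A] meet[OF A2(1) A1(1)] A2(2) A' A1' by auto
  then have "a = a1" using uniq[OF A2(1)] a a1 by blast
  then show False using a1 A1 by auto
qed

lemma parts_off_bounds: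
  assumes "t \<in> {1..p}"
  shows "parts_off t \<subseteq> {1..p}" "t \<in> parts_off t \<longleftrightarrow> k t > 1"
    "A \<in> PF \<Longrightarrow> card {v \<in> A. fst v \<in> parts_off t} \<ge> 2"
proof -
  show sub: "parts_off t \<subseteq> {1..p}" and "t \<in> parts_off t \<longleftrightarrow> k t > 1"
    using assms by (auto simp: parts_off_def)
  assume A: "A \<in> PF"
  have "(\<Sum>s\<in>parts_off t. k s) \<ge> 2"
  proof (cases "k t > 1")
    case True
    then show ?thesis using k_le_K[OF assms] by (simp add: parts_off_def K_def)
  next
    case False
    then have kt: "k t = 1" using k_pos[OF assms] by simp
    have "K = k t + (\<Sum>s\<in>{1..p} - {t}. k s)"
      unfolding K_def using assms by (intro sum.remove) auto
    then show ?thesis using K_ge_3[OF assms kt] False kt by (simp add: parts_off_def)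
  qed
  then show "card {v \<in> A. fst v \<in> parts_off t} \<ge> 2" using card_restrict_part[OF A sub] by simp
qed

lemma card_HM_parts_off_le_max:
  assumes "x \<in> V" "A \<in> PF" "x \<notin> A"
  shows "int (card (HM x {v \<in> A. fst v \<in> parts_off (fst x)})) \<le> M"
  using assms parts_off_bounds[OF part_range[OF assms(1)]] by (intro card_HM_le_max) auto

lemma in_parts_off:
  assumes "valid {a, b}" "a \<noteq> b"
  shows "fst b \<in> parts_off (fst a)"
proof -
  have "b \<in> V" using valid_V[OF assms(1)] by simp
  then show ?thesis using same_part_k[OF assms] part_range[of b] by (auto simp: parts_off_def)
qed

text \<open>This gives \<open>M\<close> its scale: a family centred at a whose \<open>B\<close>
  contains b includes all of \<open>up {a, b}\<close>.\<close>

lemma w_pair_le_max: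
  assumes "valid {a, b}" "a \<noteq> b"
  shows "w {a, b} \<le> M"
proof -
  have V: "a \<in> V" "b \<in> V" using valid_V[OF assms(1)] by auto
  have "\<exists>X\<in>PF. {b} \<subseteq> X \<and> X \<inter> {a} = {}"
    by (rule valid_avoiding) (use assms valid_subset V K_pos in auto)
  then obtain X where X: "X \<in> PF" "b \<in> X" "a \<notin> X" by auto
  let ?H = "HM a {v \<in> X. fst v \<in> parts_off (fst a)}"
  have "up {a, b} \<subseteq> ?H" using X in_parts_off[OF assms] by (auto simp: HM_def upd_def)
  then have "card (up {a, b}) \<le> card ?H" by (intro card_mono finite_HM)
  then show ?thesis using card_HM_parts_off_le_max[OF V(1) X(1,3)] by (simp add: w_def)
qed

text \<open>A member meets the fixed \<open>A0\<close> in some y, and it meets \<open>f y\<close>, a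
  member missing y, in some z. Without edges inside it, {y, z} is no edge, so a third member misses
  both, and at most \<open>M\<close> / (8 K^2) such members contain the pair. There are at most K^2
  choices of (y, z).\<close>

lemma card_edgeless_le:
  "8 * real (card {A \<in> F. \<forall>a b. edge a b \<longrightarrow> \<not> {a, b} \<subseteq> A}) \<le> M"
proof -
  define F0 where "F0 = {A \<in> F. \<forall>a b. edge a b \<longrightarrow> \<not> {a, b} \<subseteq> A}"
  obtain A0 where A0: "A0 \<in> F" using F_nonempty by blast
  have "\<forall>y\<in>A0. \<exists>A\<in>F. y \<notin> A" using nontriv F_V[OF A0] by blast
  then obtain f where f: "\<And>y. y \<in> A0 \<Longrightarrow> f y \<in> F \<and> y \<notin> f y" by metis
  define G where "G y z = {A \<in> F0. y \<in> A \<and> z \<in> A}" for y z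
  have G: "8 * real K ^ 2 * real (card (G y z)) \<le> M" if yz: "y \<noteq> z" "y \<in> A0" "z \<in> f y" for y z
  proof (cases "G y z = {}")
    case True
    \<comment> \<open>Only nonnegativity of the integer \<open>M\<close> is needed here. It is read
      off from any pair inside a member, hence the detour through K >= 2.\<close>
    obtain B where "B \<in> F" using F_nonempty by blast
    have "K \<ge> 2"
    proof -
      have "k 1 = 1 \<Longrightarrow> K \<ge> 3" using K_ge_3[of 1] p_pos by auto
      moreover have "k 1 > 1 \<Longrightarrow> K \<ge> 2" using k_le_K[of 1] p_pos by auto
      ultimately show ?thesis using k_pos[of 1] p_pos by fastforce
    qed
    then obtain a b where "a \<in> B" "b \<in> B" "a \<noteq> b"
      using F_card[OF \<open>B \<in> F\<close>] card_le_Suc0_iff_eq[OF F_finite[OF \<open>B \<in> F\<close>]] by fastforce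
    then have "w {a, b} \<le> M" using F_valid[OF \<open>B \<in> F\<close>] by (intro w_pair_le_max) auto
    then have "0 \<le> real_of_int M" using w_nonneg[of "{a, b}"] by linarith
    then show ?thesis using True by simp
  next
    case False
    then obtain A where "A \<in> G y z" by blast
    then have A: "A \<in> F" "{y, z} \<subseteq> A" "\<not> edge y z" unfolding G_def F0_def by blast+
    have v: "valid {y, z}" using A F_valid by blast
    then obtain A' where A': "A' \<in> F" "y \<notin> A'" "z \<notin> A'" using A yz by (auto simp: edge_def)
    have "8 * real K ^ 2 * real (card (G y z)) \<le> w {y, z}"
    proof (rule card_meeting_small)
      show "G y z \<subseteq> up {y, z}" using F_sub by (auto simp: G_def F0_def upd_def)
      show "A' \<subseteq> V" "card A' \<le> K" "A' \<inter> {y, z} = {}" using A' F_V F_card by auto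
      show "X \<inter> A' \<noteq> {}" if "X \<in> G y z" for X using meet that A'(1) by (auto simp: G_def F0_def)
    qed auto
    then show ?thesis using w_pair_le_max[OF v yz(1)] by linarith
  qed
  have "F0 \<subseteq> (\<Union>y\<in>A0. \<Union>z\<in>f y. G y z)"
  proof
    fix A assume A: "A \<in> F0"
    then have "A \<in> F" by (auto simp: F0_def)
    then obtain y where y: "y \<in> A0" "y \<in> A" using meet[OF A0] by blast
    then obtain z where "z \<in> f y" "z \<in> A" using meet \<open>A \<in> F\<close> f by blast
    then show "A \<in> (\<Union>y\<in>A0. \<Union>z\<in>f y. G y z)" using y A by (auto simp: G_def)
  qed
  then have "card F0 \<le> card (\<Union>y\<in>A0. \<Union>z\<in>f y. G y z)"
    using F_finite f A0 finite_F by (intro card_mono finite_UN_I) (auto simp: G_def F0_def)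
  also have "\<dots> \<le> (\<Sum>y\<in>A0. card (\<Union>z\<in>f y. G y z))"
    using F_finite A0 by (intro card_UN_le) auto
  also have "\<dots> \<le> (\<Sum>y\<in>A0. \<Sum>z\<in>f y. card (G y z))"
    using F_finite f by (intro sum_mono card_UN_le) auto
  finally have "real (card F0) \<le> real (\<Sum>y\<in>A0. \<Sum>z\<in>f y. card (G y z))" by (simp only: of_nat_le_iff)
  then have "8 * real K ^ 2 * real (card F0) \<le> 8 * real K ^ 2 * real (\<Sum>y\<in>A0. \<Sum>z\<in>f y. card (G y z))"
    by (intro mult_left_mono) auto
  also have "\<dots> = (\<Sum>y\<in>A0. \<Sum>z\<in>f y. 8 * real K ^ 2 * real (card (G y z)))"
    by (simp add: sum_distrib_left mult_ac)
  also have "\<dots> \<le> (\<Sum>y\<in>A0. \<Sum>z\<in>f y. real_of_int M)"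
    using f by (intro sum_mono G) auto
  also have "\<dots> = (\<Sum>y\<in>A0. K * real_of_int M)"
    using f F_card by (intro sum.cong) auto
  also have "\<dots> = real K ^ 2 * M" using F_card[OF A0] by (simp add: power2_eq_square)
  finally have "real K ^ 2 * (8 * real (card F0)) \<le> real K ^ 2 * M" by (simp add: mult_ac)
  then have "8 * real (card F0) \<le> M" using K_pos by simp
  then show ?thesis unfolding F0_def .
qed

section \<open>Stars\<close>

definition star_centre :: "nat \<times> nat \<Rightarrow> bool" where
  "star_centre x \<longleftrightarrow> x \<in> V \<and> (\<forall>a b. edge a b \<longrightarrow> x = a \<or> x = b)"

definition leaves :: "nat \<times> nat \<Rightarrow> (nat \<times> nat) set" where
  "leaves x = {y. edge x y}"

lemma leavesD:
  assumes "y \<in> leaves x"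
  shows "y \<noteq> x" "valid {x, y}" "y \<in> V" "x \<in> V"
proof -
  show "y \<noteq> x" "valid {x, y}" using assms by (auto simp: leaves_def edge_def)
  then show "y \<in> V" "x \<in> V" using valid_V[of "{x, y}"] by auto
qed

lemma leaves_subset: "A \<in> F \<Longrightarrow> x \<notin> A \<Longrightarrow> leaves x \<subseteq> A"
  unfolding leaves_def edge_def by blast

lemma leaves_fin:
  assumes "x \<in> V"
  shows "finite (leaves x)" "card (leaves x) \<le> K" "valid (leaves x)" "leaves x \<subseteq> V" "x \<notin> leaves x"
proof -
  obtain A where A: "A \<in> F" "x \<notin> A" using nontriv assms by blast
  then have s: "leaves x \<subseteq> A" by (rule leaves_subset)
  then show "finite (leaves x)" using F_finite[OF A(1)] finite_subset by blast
  show v: "valid (leaves x)" using F_valid[OF A(1) s] .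
  show "card (leaves x) \<le> K" by (rule valid_card[OF v])
  show "leaves x \<subseteq> V" by (rule valid_V[OF v])
  show "x \<notin> leaves x" using s A by blast
qed

text \<open>If all leaves gave less than \<open>M\<close> / (2 K), the members containing an edge
  would number at most \<open>M\<close> / 2 and the others at most \<open>M\<close> / 8. In
  particular there is an edge, although \<open>star_centre\<close> holds vacuously without
  edges.\<close>

lemma star_large_leaf:
  assumes "star_centre x" "int (card F) > M"
  shows "\<exists>q\<in>leaves x. M \<le> 2 * real K * w {x, q}"
proof (rule ccontr)
  assume neg: "\<not> ?thesis"
  have xV: "x \<in> V" using assms by (simp add: star_centre_def)
  note L = leaves_fin[OF xV]
  define F0 where "F0 = {A \<in> F. \<forall>a b. edge a b \<longrightarrow> \<not> {a, b} \<subseteq> A}"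
  have F0: "8 * real (card F0) \<le> M" using card_edgeless_le unfolding F0_def .
  have "F \<subseteq> F0 \<union> (\<Union>y\<in>leaves x. up {x, y})"
  proof
    fix A assume A: "A \<in> F"
    show "A \<in> F0 \<union> (\<Union>y\<in>leaves x. up {x, y})"
    proof (cases "A \<in> F0")
      case False
      then obtain a b where ab: "edge a b" "{a, b} \<subseteq> A" using A unfolding F0_def by blast
      then have "x = a \<or> x = b" using assms(1) unfolding star_centre_def by blast
      then obtain y where y: "edge x y" "{x, y} \<subseteq> A" using ab edge_commute by blast
      have "A \<in> up {x, y}" using y A F_sub unfolding upd_def by blast
      then show ?thesis using y(1) unfolding leaves_def by blast
    qed simp
  qed
  then have "card F \<le> card (F0 \<union> (\<Union>y\<in>leaves x. up {x, y}))"
    using finite_F L finite_upd by (intro card_mono) (auto simp: F0_def)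
  also have "\<dots> \<le> card F0 + card (\<Union>y\<in>leaves x. up {x, y})" by (rule card_Un_le)
  also have "\<dots> \<le> card F0 + (\<Sum>y\<in>leaves x. card (up {x, y}))"
    using L by (intro add_left_mono card_UN_le)
  finally have "real (card F) \<le> real (card F0 + (\<Sum>y\<in>leaves x. card (up {x, y})))"
    by (simp only: of_nat_le_iff)
  then have 1: "real (card F) \<le> real (card F0) + (\<Sum>y\<in>leaves x. w {x, y})" by (simp add: w_def)
  have Mnn: "0 \<le> real_of_int M" using F0 by (rule order_trans[rotated]) simp
  have "2 * real K * (\<Sum>y\<in>leaves x. w {x, y}) \<le> real (card (leaves x)) * M"
    unfolding sum_distrib_left using neg by (intro sum_bounded_above) (simp add: not_le less_imp_le)
  also have "\<dots> \<le> real K * real_of_int M" using L(2) Mnn by (intro mult_right_mono) auto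
  finally have "real K * (2 * (\<Sum>y\<in>leaves x. w {x, y})) \<le> real K * M" by simp
  then have "2 * (\<Sum>y\<in>leaves x. w {x, y}) \<le> M" using K_pos by simp
  moreover have "real (card F) > M" using assms(2) by linarith
  ultimately show False using 1 F0 Mnn by linarith
qed

text \<open>Every pair weighs at most \<open>M\<close>, hence at most 2 K times as much as {x, q};
  the other factor K^2 is the cost of \<open>w_le\<close> for two elements.\<close>

lemma star_dominant:
  assumes "q \<in> leaves x" "M \<le> 2 * real K * w {x, q}" "valid {a, b}" "a \<noteq> b"
  shows "om a * om b \<le> 2 * real K ^ 3 * (om x * om q)"
proof -
  note q = leavesD[OF assms(1)]
  have "w {} * prod om {a, b} \<le> w {a, b}" using assms by (intro w_ge) auto
  also have "\<dots> \<le> M" by (rule w_pair_le_max[OF assms(3,4)])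
  also have "\<dots> \<le> 2 * real K * w {x, q}" by (rule assms(2))
  also have "\<dots> \<le> 2 * real K * (w {} * real K ^ card {x, q} * prod om {x, q})"
    using q by (intro mult_left_mono w_le) auto
  also have "\<dots> = w {} * (2 * real K ^ 3 * (om x * om q))"
    using q by (simp add: power2_eq_square power3_eq_cube)
  finally show ?thesis using assms(4) w_empty_pos by simp
qed

text \<open>The pair {q, b} is valid because both leaves lie in a member avoiding x, and
  \<open>om q\<close> cancels. A leaf other than q can thus be traded for x, whatever their parts
  are.\<close>

lemma star_dominant_leaf:
  assumes "q \<in> leaves x" "M \<le> 2 * real K * w {x, q}" "b \<in> leaves x" "b \<noteq> q"
  shows "om b \<le> 2 * real K ^ 3 * om x"
proof -
  have "valid {q, b}"
    using leaves_fin(3)[OF leavesD(4)[OF assms(1)]] by (rule valid_subset) (use assms in auto)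
  then have "om q * om b \<le> 2 * real K ^ 3 * (om x * om q)"
    using assms by (intro star_dominant) auto
  then have "om q * om b \<le> om q * (2 * real K ^ 3 * om x)" by (simp add: mult_ac)
  then show ?thesis using om_pos[OF leavesD(3)[OF assms(1)]] by simp
qed

text \<open>The comparison shared by both star arguments. Members through x lie in
  \<open>HM x B\<close>, so the loss is confined to members avoiding x; the gain includes all sets
  through x and u outside \<open>F\<close>. Both meet at 7/8 of the weight of {x, u}.\<close>

lemma star_card_le:
  assumes "x \<in> V" "A \<in> F" "x \<notin> A" and B: "B = {v \<in> A. fst v \<in> Q}"
    and Q: "Q \<subseteq> {1..p}" "fst x \<in> Q \<longleftrightarrow> k (fst x) > 1" "card B \<ge> 2"
    and meetB: "\<And>X. X \<in> F \<Longrightarrow> x \<in> X \<Longrightarrow> X \<inter> B \<noteq> {}"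
    and u: "u \<in> B"
    and gain: "7 * w {x, u} \<le> 8 * real (card (up {x, u} - F))"
    and loss: "8 * real (card {X \<in> F. x \<notin> X}) \<le> 7 * w {} * (om x * om u)"
  shows "int (card F) \<le> M"
proof -
  have H: "int (card (HM x B)) \<le> M"
    using card_HM_le_max[OF assms(1) _ assms(3) Q(1,2)] assms(2) F_sub Q(3) unfolding B by blast
  have xu: "x \<noteq> u" using u assms(3) B by auto
  have uV: "u \<in> V" using u B F_V[OF assms(2)] by auto
  have "fst u \<in> Q" using u B by auto
  then have v: "valid {x, u}" using Q(2) by (intro valid_pairI[OF assms(1) uV xu]) simp
  have "F - HM x B \<subseteq> {X \<in> F. x \<notin> X}" using meetB F_sub unfolding HM_def by blast
  then have "card (F - HM x B) \<le> card {X \<in> F. x \<notin> X}" by (intro card_mono) (simp_all add: finite_F)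
  then have "8 * real (card (F - HM x B)) \<le> 8 * real (card {X \<in> F. x \<notin> X})" by simp
  also have "\<dots> \<le> 7 * w {} * (om x * om u)" by (rule loss)
  also have "\<dots> = 7 * (w {} * prod om {x, u})" using xu by simp
  also have "\<dots> \<le> 7 * w {x, u}" by (intro mult_left_mono w_ge) (use v in auto)
  also have "\<dots> \<le> 8 * real (card (up {x, u} - F))" by (rule gain)
  finally have "real (card (F - HM x B)) \<le> real (card (up {x, u} - F))" by simp
  then have "card (F - HM x B) \<le> card (up {x, u} - F)" by (simp only: of_nat_le_iff)
  also have "\<dots> \<le> card (HM x B - F)"
  proof (rule card_mono)
    show "finite (HM x B - F)" by (simp add: finite_HM)
    have "X \<in> HM x B" if "X \<in> up {x, u}" for X using that u by (auto simp: HM_def upd_def)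
    then show "up {x, u} - F \<subseteq> HM x B - F" by blast
  qed
  finally have "card (F - HM x B) \<le> card (HM x B - F)" .
  then have "card F \<le> card (HM x B)" by (rule card_le_by_diff[OF finite_HM finite_F])
  then show ?thesis using H by linarith
qed

lemma insert_fibre_lt:
  assumes "insert v T \<subseteq> A" "v \<notin> T" "A \<in> F"
  shows "card (T `` {fst v}) < k (fst v)"
  using w_insert_eq(2)[OF _ assms(2)] F_valid[OF assms(3,1)] by blast

text \<open>
When some member through x misses all leaves, every member avoiding x contains, besides all
leaves, a further element of that member. This gains a factor om v, and v lies in a part that
also contains an element u of A which is not a leaf. With a single leaf q the factor om x that is
still needed comes from centring the star at the heavier end of its only edge.
\<close>

lemma star_escape:
  assumes star: "star_centre x"
    and q: "q \<in> leaves x" "M \<le> 2 * real K * w {x, q}"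
    and second: "(\<exists>b\<in>leaves x. b \<noteq> q) \<or> om q \<le> om x"
    and C: "C \<in> F" "x \<in> C" "C \<inter> leaves x = {}"
  shows "int (card F) \<le> M"
proof -
  define L where "L = leaves x"
  define t where "t = fst x"
  have xV: "x \<in> V" using star by (simp add: star_centre_def)
  have tp: "t \<in> {1..p}" using part_range[OF xV] by (simp add: t_def)
  note L = leaves_fin[OF xV, folded L_def]
  obtain A where A: "A \<in> F" "x \<notin> A" using nontriv xV by blast
  have LA: "L \<subseteq> A" using leaves_subset[OF A] by (simp add: L_def)
  \<comment> \<open>The parts that can hold a common element of \<open>C\<close> and a member
    avoiding x: it occurs together with x in \<open>C\<close>, and together with all of
    \<open>L\<close>, to which it does not belong, in the other member.\<close>
  define R where "R = {s \<in> parts_off t. card (L `` {s}) < k s}"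
  define C' where "C' = {v \<in> C. fst v \<in> R \<and> v \<noteq> x}"
  have C'V: "C' \<subseteq> V" "finite C'" "card C' \<le> K" "C' \<inter> L = {}"
  proof -
    have "C' \<subseteq> C" by (auto simp: C'_def)
    then show "C' \<subseteq> V" "C' \<inter> L = {}" using F_V[OF C(1)] C(3) unfolding L_def by blast+
    show "finite C'" using \<open>C' \<subseteq> C\<close> F_finite[OF C(1)] by (rule finite_subset)
    show "card C' \<le> K" using card_mono[OF F_finite[OF C(1)] \<open>C' \<subseteq> C\<close>] F_card[OF C(1)] by simp
  qed
  have inC': "X \<inter> C' \<noteq> {}" if X: "X \<in> F" "x \<notin> X" for X
  proof -
    obtain v where v: "v \<in> X" "v \<in> C" using meet[OF X(1) C(1)] by blast
    have "v \<notin> L" "v \<noteq> x" using v C(3) X by (auto simp: L_def)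
    moreover have "L \<subseteq> X" using leaves_subset[OF X] by (simp add: L_def)
    ultimately have "card (L `` {fst v}) < k (fst v)" using insert_fibre_lt[of v L X] v X by blast
    moreover have "valid {x, v}" using F_valid[OF C(1)] C(2) v by simp
    then have "fst v \<in> parts_off t" using in_parts_off \<open>v \<noteq> x\<close> unfolding t_def by blast
    ultimately have "v \<in> C'" using v \<open>v \<noteq> x\<close> unfolding C'_def R_def by blast
    then show ?thesis using v by blast
  qed
  have "R \<noteq> {}" using inC'[OF A] by (auto simp: C'_def)
  moreover have "finite R"
    by (rule finite_subset[of _ "{1..p}"]) (use parts_off_bounds(1)[OF tp] in \<open>auto simp: R_def\<close>)
  ultimately have "Min (n ` R) \<in> n ` R" and min_le: "\<And>r. r \<in> R \<Longrightarrow> Min (n ` R) \<le> n r" by auto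
  \<comment> \<open>The smallest of these parts has the largest \<open>om\<close>; u will be taken
    there, so that \<open>om u\<close> bounds \<open>om v\<close> for all v in
    \<open>C'\<close>.\<close>
  then obtain s where s: "s \<in> R" "\<And>r. r \<in> R \<Longrightarrow> n s \<le> n r" by auto
  have sp: "s \<in> {1..p}" using s parts_off_bounds(1)[OF tp] by (auto simp: R_def)
  have "card (L `` {s}) < card (A `` {s})" using s A F_sub sp by (auto simp: R_def PF_def)
  then have "\<not> A `` {s} \<subseteq> L `` {s}" using L(1) card_mono[of "L `` {s}" "A `` {s}"] by (auto simp: finite_Image)
  then obtain i where "(s, i) \<in> A" "(s, i) \<notin> L" by blast
  then obtain u where u: "u \<in> A" "u \<notin> L" "fst u = s" by force
  have uV: "u \<in> V" using u F_V[OF A(1)] by auto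
  have om_u: "om v \<le> om u" if "v \<in> C'" for v
  proof -
    have "n s \<le> n (fst v)" using that s(2) by (simp add: C'_def)
    then show ?thesis using n_pos[OF uV] u(3) by (simp add: om_def frac_le)
  qed
  define B where "B = {v \<in> A. fst v \<in> parts_off t}"
  have uB: "u \<in> B" using u s by (auto simp: B_def R_def)
  have xu: "x \<noteq> u" using u A by blast
  have pos: "om x > 0" "om u > 0" "w {} > 0" "real K > 0"
    using om_pos xV uV w_empty_pos K_pos by auto
  define G where "G = {X \<in> F. x \<notin> X}"
  have GL: "G \<subseteq> up L" using leaves_subset F_sub unfolding G_def L_def upd_def by blast
  have bound: "8 * real (card G) \<le> 7 * w {} * (om x * om u)"
  proof (cases "\<exists>b\<in>L. b \<noteq> q")
    case True
    then obtain b where b: "b \<in> L" "b \<noteq> q" by blast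
    have omb: "om b \<le> 2 * real K ^ 3 * om x" using star_dominant_leaf[OF q] b unfolding L_def by blast
    have qV: "q \<in> V" "q \<in> L" using leavesD[OF q(1)] q(1) by (auto simp: L_def)
    have wL: "w L \<le> w {} * real K ^ K * (om q * om b)"
    proof -
      have "w L \<le> w {} * real K ^ card L * prod om L" using L by (intro w_le) auto
      also have "\<dots> \<le> w {} * real K ^ K * prod om {q, b}"
        using L b qV K_pos om_nonneg
        by (intro mult_mono om_prod_mono mult_left_mono power_increasing prod_nonneg mult_nonneg_nonneg) auto
      finally show ?thesis using b by simp
    qed
    have "real (card G) \<le> (\<Sum>v\<in>C'. w (insert v L))"
      using GL C'V(2) inC' by (rule card_meeting_le) (auto simp: G_def)
    also have "\<dots> \<le> (\<Sum>v\<in>C'. K * om u * w L)"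
    proof (rule sum_mono)
      fix v assume v: "v \<in> C'"
      have "w (insert v L) \<le> K * om v * w L" using v C'V by (intro w_insert_le) auto
      also have "\<dots> \<le> K * om u * w L" using om_u[OF v] by (intro mult_right_mono mult_left_mono) auto
      finally show "w (insert v L) \<le> K * om u * w L" .
    qed
    also have "\<dots> = card C' * (K * om u * w L)" by simp
    also have "\<dots> \<le> K * (K * om u * w L)"
      using C'V pos by (intro mult_right_mono) (auto intro: less_imp_le)
    also have "\<dots> \<le> K * (K * om u * (w {} * real K ^ K * (om q * (2 * real K ^ 3 * om x))))"
      using wL omb pos om_nonneg[OF qV(1)]
      by (intro mult_left_mono order_trans[OF wL]) auto
    \<comment> \<open>The exponent collects K from \<open>w_le\<close>, 3 from trading b for x, 1
      from adding v and 1 from the size of \<open>C'\<close>. The leaf q pays for it.\<close>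
    also have "\<dots> = 2 * w {} * (om x * om u) * (real K ^ (K + 5) * om q)"
      by (simp add: power_add numeral_eq_Suc mult_ac)
    finally have "8 * real (card G) \<le> 2 * w {} * (om x * om u) * (8 * real K ^ (K + 5) * om q)"
      by (simp add: mult_ac)
    also have "\<dots> \<le> 2 * w {} * (om x * om u) * 1"
      using om_le[OF qV(1), of "K + 5"] pos by (intro mult_left_mono) auto
    also have "\<dots> \<le> 7 * w {} * (om x * om u)" using pos by simp
    finally show ?thesis .
  next
    case False
    then have L1: "L = {q}" and omq: "om q \<le> om x" using False second q(1) unfolding L_def by blast+
    have Gv: "8 * real K * real (card {X \<in> G. v \<in> X}) \<le> w {} * (om x * om u)" if v: "v \<in> C'" for v
    proof (cases "{X \<in> G. v \<in> X} = {}")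
      case True
      show ?thesis unfolding True using pos by simp
    next
      case False
      then obtain X where X: "X \<in> F" "x \<notin> X" "v \<in> X" by (auto simp: G_def)
      have qX: "q \<in> X" using leaves_subset[OF X(1,2)] q(1) by blast
      have vq: "v \<noteq> q" "v \<noteq> x" using v C'V(4) L1 by (auto simp: C'_def)
      have val: "valid {q, v}" using F_valid[OF X(1)] X qX by simp
      \<comment> \<open>All edges contain x, so some member misses both q and v; its smallness
        factor replaces the absent second leaf.\<close>
      have "\<not> edge q v" using star leavesD(1)[OF q(1)] vq unfolding star_centre_def by blast
      then obtain E where E: "E \<in> F" "q \<notin> E" "v \<notin> E" using val vq unfolding edge_def by blast
      have "8 * real K ^ 3 * real (card {X \<in> G. v \<in> X}) \<le> w {q, v}"
      proof (rule card_meeting_small)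
        show "{X \<in> G. v \<in> X} \<subseteq> up {q, v}" using GL L1 unfolding upd_def by blast
        show "E \<subseteq> V" "card E \<le> K" "E \<inter> {q, v} = {}" using E F_V F_card by auto
        show "X \<inter> E \<noteq> {}" if "X \<in> {X \<in> G. v \<in> X}" for X using meet that E(1) by (auto simp: G_def)
      qed simp
      also have "\<dots> \<le> w {} * real K ^ card {q, v} * prod om {q, v}"
        by (rule w_le) (use valid_V[OF val] in auto)
      also have "\<dots> = w {} * real K ^ 2 * (om q * om v)"
        using vq by (simp add: power2_eq_square)
      also have "\<dots> \<le> w {} * real K ^ 2 * (om x * om u)"
        using omq om_u[OF v] pos xV C'V(1) v by (intro mult_left_mono mult_mono om_nonneg) auto
      finally have "real K ^ 2 * (8 * real K * real (card {X \<in> G. v \<in> X})) \<le> real K ^ 2 * (w {} * (om x * om u))"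
        by (simp add: power2_eq_square power3_eq_cube mult_ac)
      then show ?thesis using K_pos by simp
    qed
    have "G \<subseteq> (\<Union>v\<in>C'. {X \<in> G. v \<in> X})" using inC' by (auto simp: G_def)
    then have "card G \<le> card (\<Union>v\<in>C'. {X \<in> G. v \<in> X})"
      using C'V finite_F by (intro card_mono) (auto simp: G_def)
    also have "\<dots> \<le> (\<Sum>v\<in>C'. card {X \<in> G. v \<in> X})" using C'V by (intro card_UN_le)
    finally have "real (card G) \<le> real (\<Sum>v\<in>C'. card {X \<in> G. v \<in> X})" by (simp only: of_nat_le_iff)
    then have "8 * real K * real (card G) \<le> 8 * real K * real (\<Sum>v\<in>C'. card {X \<in> G. v \<in> X})"
      by (intro mult_left_mono) auto
    also have "\<dots> = (\<Sum>v\<in>C'. 8 * real K * real (card {X \<in> G. v \<in> X}))" by (simp add: sum_distrib_left)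
    also have "\<dots> \<le> (\<Sum>v\<in>C'. w {} * (om x * om u))" by (intro sum_mono Gv)
    also have "\<dots> = card C' * (w {} * (om x * om u))" by simp
    also have "\<dots> \<le> K * (w {} * (om x * om u))" using C'V pos by (intro mult_right_mono) auto
    finally have "real K * (8 * real (card G)) \<le> real K * (w {} * (om x * om u))" by simp
    then have "8 * real (card G) \<le> w {} * (om x * om u)" using K_pos by simp
    also have "\<dots> \<le> 7 * w {} * (om x * om u)" using pos by simp
    finally show ?thesis .
  qed
  have gain: "7 * w {x, u} \<le> 8 * real (card (up {x, u} - F))"
  proof -
    have val: "valid {x, u}"
      using xu xV uV uB by (intro valid_pairI) (auto simp: B_def parts_off_def t_def split: if_splits)
    \<comment> \<open>Since u is not a leaf, {x, u} is not an edge; most sets containing this pair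
      therefore lie outside \<open>F\<close>.\<close>
    then have "\<exists>E\<in>F. x \<notin> E \<and> u \<notin> E" using u(2) xu unfolding L_def leaves_def edge_def by blast
    then obtain E where E: "E \<in> F" "x \<notin> E" "u \<notin> E" by blast
    have "8 * real K ^ 0 * real (card (up {x, u} \<inter> F)) \<le> w {x, u}"
    proof (rule card_meeting_small)
      show "E \<subseteq> V" "card E \<le> K" "E \<inter> {x, u} = {}" using E F_V F_card by auto
      show "X \<inter> E \<noteq> {}" if "X \<in> up {x, u} \<inter> F" for X using meet that E(1) by auto
    qed auto
    moreover have "card (up {x, u}) = card (up {x, u} \<inter> F) + card (up {x, u} - F)"
      by (rule card_Int_Diff[OF finite_upd])
    ultimately show ?thesis by (simp add: w_def)
  qed
  show ?thesis
  proof (rule star_card_le[OF xV A B_def _ _ _ _ uB gain])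
    show "parts_off t \<subseteq> {1..p}" "fst x \<in> parts_off t \<longleftrightarrow> k (fst x) > 1" "card B \<ge> 2"
      using parts_off_bounds[OF tp] A F_sub by (auto simp: B_def t_def)
    show "X \<inter> B \<noteq> {}" if X: "X \<in> F" "x \<in> X" for X
    proof -
      obtain v where v: "v \<in> X" "v \<in> A" using meet[OF X(1) A(1)] by blast
      have "x \<noteq> v" using v A by blast
      moreover have "valid {x, v}" using F_valid[OF X(1)] X(2) v by simp
      ultimately have "fst v \<in> parts_off t" using in_parts_off unfolding t_def by blast
      then show ?thesis using v by (auto simp: B_def)
    qed
    show "8 * real (card {X \<in> F. x \<notin> X}) \<le> 7 * w {} * (om x * om u)" using bound by (simp add: G_def)
  qed
qed

text \<open>Members avoiding x contain at least three leaves, and three debts have to be paid: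
  \<open>om x\<close>, \<open>om u\<close> and the constants. The element u shares its part with x
  or with a leaf, because \<open>B\<close> is confined to such parts. With no such u off the leaves,
  \<open>F\<close> is contained in \<open>HM x B\<close> outright.\<close>

lemma star_closed:
  assumes star: "star_centre x"
    and q: "q \<in> leaves x" "M \<le> 2 * real K * w {x, q}"
    and be: "b \<in> leaves x" "e \<in> leaves x" "b \<noteq> q" "e \<noteq> q" "b \<noteq> e"
    and meetL: "\<And>X. X \<in> F \<Longrightarrow> x \<in> X \<Longrightarrow> X \<inter> leaves x \<noteq> {}"
  shows "int (card F) \<le> M"
proof -
  define L where "L = leaves x"
  have xV: "x \<in> V" using star by (simp add: star_centre_def)
  note L = leaves_fin[OF xV, folded L_def]
  note b' = be[folded L_def]
  have qL: "q \<in> L" using q(1) by (simp add: L_def)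
  obtain A where A: "A \<in> F" "x \<notin> A" using nontriv xV by blast
  have AP: "A \<in> PF" using A F_sub by blast
  have LA: "L \<subseteq> A" using leaves_subset[OF A] by (simp add: L_def)
  define Q where "Q = fst ` L \<union> (if k (fst x) > 1 then {fst x} else {})"
  define B where "B = {v \<in> A. fst v \<in> Q}"
  have LB: "L \<subseteq> B" using LA by (auto simp: B_def Q_def)
  have finB: "finite B" using F_finite[OF A(1)] by (auto simp: B_def)
  have Q: "Q \<subseteq> {1..p}"
  proof
    fix s assume "s \<in> Q"
    then consider "s = fst x" | v where "v \<in> L" "s = fst v"
      unfolding Q_def by (auto split: if_splits)
    then show "s \<in> {1..p}" using part_range[OF xV] part_range L(4) by cases blast+
  qed
  have Qt: "fst x \<in> Q \<longleftrightarrow> k (fst x) > 1"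
  proof
    assume "fst x \<in> Q"
    show "k (fst x) > 1"
    proof (rule ccontr)
      assume "\<not> k (fst x) > 1"
      then obtain y where y: "y \<in> L" "fst x = fst y" using \<open>fst x \<in> Q\<close> unfolding Q_def by auto
      then show False using same_part_k[OF leavesD(2)] leavesD(1) \<open>\<not> k (fst x) > 1\<close> unfolding L_def by blast
    qed
  qed (simp add: Q_def)
  have "card B \<ge> card {q, b}" using LB qL b' finB by (intro card_mono) auto
  then have cB: "card B \<ge> 2" using b' by simp
  have meetB: "X \<inter> B \<noteq> {}" if "X \<in> F" "x \<in> X" for X
    using meetL[OF that] LB unfolding L_def by blast
  show ?thesis
  proof (cases "B \<subseteq> L")
    case True
    have "F \<subseteq> HM x B"
    proof
      fix X assume X: "X \<in> F"
      show "X \<in> HM x B"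
      proof (cases "x \<in> X")
        case True
        then show ?thesis using meetB X F_sub unfolding HM_def by blast
      next
        case False
        then have "B \<subseteq> X" using leaves_subset[OF X] True unfolding L_def by blast
        then show ?thesis using False X F_sub unfolding HM_def by blast
      qed
    qed
    then have "card F \<le> card (HM x B)" by (intro card_mono finite_HM)
    moreover have "int (card (HM x B)) \<le> M"
      unfolding B_def using cB by (intro card_HM_le_max[OF xV AP A(2) Q Qt]) (simp add: B_def)
    ultimately show ?thesis by linarith
  next
    case False
    then obtain u where u: "u \<in> B" "u \<notin> L" by blast
    have xu: "x \<noteq> u" using u A by (auto simp: B_def)
    have uV: "u \<in> V" using u F_V[OF A(1)] by (auto simp: B_def)
    have pos: "om x > 0" "om u > 0" "w {} > 0" "real K > 0"
      using om_pos xV uV w_empty_pos K_pos by auto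
    have LV: "v \<in> V" if "v \<in> L" for v using L(4) that by blast
    have dom: "om v \<le> 2 * real K ^ 3 * om x" if "v \<in> L" "v \<noteq> q" for v
      using star_dominant_leaf[OF q] that unfolding L_def by blast
    have D1: "2 * real K ^ 3 \<ge> 1"
    proof -
      have "real K ^ 3 \<ge> 1" using K_pos by (intro one_le_power) simp
      then show ?thesis by linarith
    qed
    have small: "8 * real K ^ (K + 6) * om d \<le> 1" if "d \<in> L" for d using om_le[OF LV[OF that]] by simp
    have prodL: "8 * real K ^ (K + 6) * prod om L \<le> (2 * real K ^ 3) ^ 2 * (om x * om u)"
    proof (cases "fst u = fst x")
      case True
      \<comment> \<open>Here b and e each pay a factor \<open>om x\<close>, and q pays for the
        constants.\<close>
      then have ux: "om u = om x" by (simp add: om_def)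
      have "prod om L \<le> prod om {q, b, e}" using L qL b' by (intro om_prod_mono) auto
      also have "\<dots> = om q * (om b * om e)" using b' by simp
      also have "\<dots> \<le> om q * ((2 * real K ^ 3 * om x) * (2 * real K ^ 3 * om x))"
        using dom b' pos qL LV om_nonneg by (intro mult_left_mono mult_mono) auto
      finally have "8 * real K ^ (K + 6) * prod om L
          \<le> 8 * real K ^ (K + 6) * (om q * ((2 * real K ^ 3 * om x) * (2 * real K ^ 3 * om x)))"
        by (intro mult_left_mono) auto
      also have "\<dots> = (8 * real K ^ (K + 6) * om q) * ((2 * real K ^ 3) ^ 2 * (om x * om u))"
        unfolding ux by (simp add: power2_eq_square mult_ac)
      also have "\<dots> \<le> 1 * ((2 * real K ^ 3) ^ 2 * (om x * om u))"
        using pos by (intro mult_right_mono small qL) auto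
      finally show ?thesis by simp
    next
      case False
      then obtain y where y: "y \<in> L" "fst u = fst y"
        using u(1) unfolding B_def Q_def by (auto split: if_splits)
      then have uy: "om u = om y" by (simp add: om_def)
      \<comment> \<open>The leaf y pays for u, being in the same part, c pays for x by
        \<open>dom\<close>, which requires c to differ from q, and d pays for the constants.\<close>
      obtain c d where cd: "c \<in> L" "d \<in> L" "c \<noteq> y" "d \<noteq> y" "c \<noteq> d" "c \<noteq> q"
      proof (cases "y = q")
        case True
        then show ?thesis using that[of b e] b' by auto
      next
        case yq: False
        show ?thesis
        proof (cases "y = b")
          case True
          then show ?thesis using that[of e q] b' qL yq by auto
        next
          case False
          then show ?thesis using that[of b q] b' qL yq by auto
        qed
      qed
      have "prod om L \<le> prod om {y, c, d}" using L y cd by (intro om_prod_mono) auto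
      also have "\<dots> = om d * (om u * om c)" using cd uy by simp
      also have "\<dots> \<le> om d * (om u * (2 * real K ^ 3 * om x))"
        using dom cd pos LV om_nonneg by (intro mult_left_mono) auto
      finally have "8 * real K ^ (K + 6) * prod om L
          \<le> 8 * real K ^ (K + 6) * (om d * (om u * (2 * real K ^ 3 * om x)))"
        by (intro mult_left_mono) auto
      also have "\<dots> = (8 * real K ^ (K + 6) * om d) * (2 * real K ^ 3 * (om x * om u))"
        by (simp add: mult_ac)
      also have "\<dots> \<le> 1 * (2 * real K ^ 3 * (om x * om u))"
        using pos by (intro mult_right_mono small cd) auto
      also have "\<dots> \<le> (2 * real K ^ 3) ^ 2 * (om x * om u)"
      proof -
        have "2 * real K ^ 3 * 1 \<le> 2 * real K ^ 3 * (2 * real K ^ 3)"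
          using D1 by (intro mult_left_mono) auto
        then show ?thesis using pos by (simp add: power2_eq_square)
      qed
      finally show ?thesis .
    qed
    have "{X \<in> F. x \<notin> X} \<subseteq> up L" using leaves_subset F_sub unfolding L_def upd_def by blast
    then have "real (card {X \<in> F. x \<notin> X}) \<le> w L"
      unfolding w_def using finite_upd by (intro of_nat_mono card_mono)
    also have "\<dots> \<le> w {} * real K ^ card L * prod om L" using L by (intro w_le) auto
    also have "\<dots> \<le> w {} * real K ^ K * prod om L"
      using L K_pos LV om_nonneg
      by (intro mult_right_mono mult_left_mono power_increasing prod_nonneg) auto
    finally have l1: "real (card {X \<in> F. x \<notin> X}) \<le> w {} * real K ^ K * prod om L" .
    have "real K ^ 6 * (8 * real (card {X \<in> F. x \<notin> X})) \<le> real K ^ 6 * (8 * (w {} * real K ^ K * prod om L))"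
      using l1 by (intro mult_left_mono) auto
    also have "\<dots> = w {} * (8 * real K ^ (K + 6) * prod om L)" by (simp add: power_add mult_ac)
    also have "\<dots> \<le> w {} * ((2 * real K ^ 3) ^ 2 * (om x * om u))"
      using prodL by (intro mult_left_mono) auto
    also have "\<dots> = real K ^ 6 * (4 * w {} * (om x * om u))" by (simp add: power_mult_distrib power_mult[symmetric])
    finally have "8 * real (card {X \<in> F. x \<notin> X}) \<le> 4 * w {} * (om x * om u)" using pos by simp
    also have "\<dots> \<le> 7 * w {} * (om x * om u)" using pos by simp
    finally have loss: "8 * real (card {X \<in> F. x \<notin> X}) \<le> 7 * w {} * (om x * om u)" .
    have "7 * w {x, u} \<le> 8 * real (card (upd {x, u} L))"
      using L u xu by (intro card_upd_ge) auto
    also have "\<dots> \<le> 8 * real (card (up {x, u} - F))"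
    proof (intro mult_left_mono of_nat_mono card_mono)
      show "upd {x, u} L \<subseteq> up {x, u} - F" using meetL unfolding L_def upd_def by blast
    qed (simp_all add: finite_upd)
    finally show ?thesis
      using loss by (intro star_card_le[OF xV A B_def Q Qt cB meetB u(1)])
  qed
qed

text \<open>A triangle of edges gives the elements at once. In a star, a member through x contains a
  leaf and a member avoiding x contains all leaves, so exactly two leaves are wanted: one leaf would
  make the family trivial, and three are excluded by \<open>star_closed\<close>.\<close>

lemma large_family_two_of:
  assumes "int (card F) > M"
  shows "\<exists>x y z. x \<noteq> y \<and> x \<noteq> z \<and> y \<noteq> z \<and> valid {x, y} \<and> valid {x, z} \<and> valid {y, z} \<and> F \<subseteq> two_of x y z"
proof (cases "\<exists>a b c. edge a b \<and> edge b c \<and> edge a c")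
  case True
  then obtain a b c where abc: "edge a b" "edge b c" "edge a c" by blast
  have "F \<subseteq> two_of a b c" using abc F_sub unfolding edge_def two_of_def by blast
  moreover have "a \<noteq> b \<and> a \<noteq> c \<and> b \<noteq> c \<and> valid {a, b} \<and> valid {a, c} \<and> valid {b, c}"
    using abc by (simp add: edge_def)
  ultimately show ?thesis by (intro exI[of _ a] exI[of _ b] exI[of _ c]) simp
next
  case no_triangle: False
  have "\<exists>x. star_centre x"
  proof (cases "\<exists>a b. edge a b")
    case True
    then obtain a b where ab: "edge a b" by blast
    then have V: "a \<in> V" "b \<in> V" using valid_V[of "{a, b}"] by (auto simp: edge_def)
    show ?thesis
    proof (rule ccontr)
      \<comment> \<open>An edge at b avoiding a and an edge at a avoiding b have to meet, so their
        other ends coincide and close a triangle with a b.\<close>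
      assume neg: "\<not> ?thesis"
      obtain c d where cd: "edge c d" "a \<noteq> c" "a \<noteq> d" using neg V unfolding star_centre_def by blast
      obtain e f where ef: "edge e f" "b \<noteq> e" "b \<noteq> f" using neg V unfolding star_centre_def by blast
      obtain c' where c': "edge b c'" "a \<noteq> c'"
      proof -
        have "b = c \<or> b = d" using edges_meet[OF ab cd(1)] cd by blast
        then show ?thesis
        proof
          assume "b = c"
          with cd show ?thesis by (intro that[of d]) simp_all
        next
          assume "b = d"
          with cd show ?thesis by (intro that[of c]) (simp_all add: edge_commute[of d c])
        qed
      qed
      obtain e' where e': "edge a e'" "b \<noteq> e'"
      proof -
        have "a = e \<or> a = f" using edges_meet[OF ab ef(1)] ef by blast
        then show ?thesis
        proof
          assume "a = e"
          with ef show ?thesis by (intro that[of f]) simp_all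
        next
          assume "a = f"
          with ef show ?thesis by (intro that[of e]) (simp_all add: edge_commute[of f e])
        qed
      qed
      have "a \<noteq> b" using ab by (simp add: edge_def)
      then have "c' = e'" using edges_meet[OF c'(1) e'(1)] c' e' by blast
      with e'(1) have "edge a c'" by simp
      with no_triangle ab c'(1) show False by blast
    qed
  next
    case False
    then show ?thesis using V_nonempty unfolding star_centre_def by blast
  qed
  then obtain x where star: "star_centre x" by blast
  then have xV: "x \<in> V" by (simp add: star_centre_def)
  obtain q where q: "q \<in> leaves x" "M \<le> 2 * real K * w {x, q}"
    using star_large_leaf[OF star assms] by blast
  have meetL: "X \<inter> leaves x \<noteq> {}" if X: "X \<in> F" "x \<in> X" for X
  proof
    assume dis: "X \<inter> leaves x = {}"
    have "\<not> ((\<exists>b\<in>leaves x. b \<noteq> q) \<or> om q \<le> om x)"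
      using star_escape[OF star q _ X dis] assms by linarith
    then have "leaves x \<subseteq> {q}" "\<not> om q \<le> om x" by blast+
    then have om: "om x \<le> om q" by simp
    have L: "leaves x = {q}" using q(1) \<open>leaves x \<subseteq> {q}\<close> by blast
    have star': "star_centre q"
      unfolding star_centre_def
    proof (intro conjI allI impI)
      show "q \<in> V" by (rule leavesD(3)[OF q(1)])
      fix a b assume ab: "edge a b"
      then have "x = a \<or> x = b" using star unfolding star_centre_def by blast
      then have "a \<in> leaves x \<or> b \<in> leaves x"
        using ab edge_commute[of a b] unfolding leaves_def by auto
      then show "q = a \<or> q = b" unfolding L by auto
    qed
    have xq: "x \<in> leaves q" using q(1) edge_commute[of x q] unfolding leaves_def by simp
    have L': "leaves q \<subseteq> {x}"
    proof
      fix e assume "e \<in> leaves q"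
      then have "edge q e" by (simp add: leaves_def)
      then have "x = q \<or> x = e" using star unfolding star_centre_def by blast
      then show "e \<in> {x}" using leavesD(1)[OF q(1)] by auto
    qed
    \<comment> \<open>The witness for \<open>star_escape\<close> at the new centre q: a member
      avoiding x contains q and misses x, the only possible leaf of q.\<close>
    obtain C where C: "C \<in> F" "x \<notin> C" using nontriv xV by blast
    then have qC: "q \<in> C" using leaves_subset q(1) by blast
    have "int (card F) \<le> M"
    proof (rule star_escape[OF star' xq _ _ C(1) qC])
      show "M \<le> 2 * real K * w {q, x}" using q(2) by (simp add: insert_commute)
      show "C \<inter> leaves q = {}" using L' C(2) by blast
    qed (use om in simp)
    then show False using assms by linarith
  qed
  have qV: "q \<in> V" by (rule leavesD(3)[OF q(1)])
  have "leaves x \<noteq> {q}"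
  proof
    assume L: "leaves x = {q}"
    obtain X where X: "X \<in> F" "q \<notin> X" using nontriv qV by blast
    show False
    proof (cases "x \<in> X")
      case True
      then show False using meetL[OF X(1)] X(2) unfolding L by simp
    next
      case False
      then have "leaves x \<subseteq> X" by (rule leaves_subset[OF X(1)])
      then show False using X(2) unfolding L by simp
    qed
  qed
  then obtain b where b: "b \<in> leaves x" "b \<noteq> q" using q(1) by blast
  have "leaves x \<subseteq> {q, b}"
  proof
    fix e assume "e \<in> leaves x"
    then have "int (card F) \<le> M" if "e \<noteq> q" "b \<noteq> e"
      using that by (intro star_closed[OF star q b(1) _ b(2) _ _ meetL])
    then show "e \<in> {q, b}" using assms by auto
  qed
  then have L: "leaves x = {q, b}" using q(1) b(1) by blast
  have "F \<subseteq> two_of x q b"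
  proof
    fix X assume X: "X \<in> F"
    then have "X \<in> PF" using F_sub by blast
    then show "X \<in> two_of x q b"
      using meetL[OF X] leaves_subset[OF X, of x] unfolding two_of_def L by (cases "x \<in> X") auto
  qed
  moreover have "valid {q, b}" using leaves_fin(3)[OF xV] L by simp
  moreover have "x \<noteq> q" "x \<noteq> b" "q \<noteq> b" using leavesD(1)[OF q(1)] leavesD(1)[OF b(1)] b(2) by blast+
  moreover have "valid {x, q}" "valid {x, b}" by (rule leavesD(2)[OF q(1)], rule leavesD(2)[OF b(1)])
  ultimately show ?thesis by (intro exI[of _ x] exI[of _ q] exI[of _ b]) simp
qed

end

section \<open>Families with two of three given elements\<close>

context multipart
begin

section \<open>Hilton-Milner families centred at a vertex of the triangle\<close>

definition triangle :: "nat \<times> nat \<Rightarrow> nat \<times> nat \<Rightarrow> nat \<times> nat \<Rightarrow> bool" where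
  "triangle x y z \<longleftrightarrow> x \<noteq> y \<and> x \<noteq> z \<and> y \<noteq> z \<and> valid {x, y} \<and> valid {x, z} \<and> valid {y, z}"

lemma triangle_commute: "triangle x y z \<Longrightarrow> triangle y x z" "triangle x y z \<Longrightarrow> triangle x z y"
  by (auto simp: triangle_def insert_commute)

lemma triangle_V: assumes "triangle x y z" shows "x \<in> V" "y \<in> V" "z \<in> V"
  using assms valid_V[of "{x, y}"] valid_V[of "{x, z}"] by (auto simp: triangle_def)

text \<open>The smallest choice of parts that puts y and z into \<open>B\<close> and satisfies the
  condition of \<open>card_HM\<close> on the part of x.\<close>

definition HM_parts :: "nat \<times> nat \<Rightarrow> nat \<times> nat \<Rightarrow> nat \<times> nat \<Rightarrow> nat set" where
  "HM_parts x y z = {fst y, fst z} \<union> (if k (fst x) > 1 then {fst x} else {})"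

lemma triangle_HM:
  assumes T: "triangle x y z"
  obtains B where "B \<subseteq> V" "finite B" "x \<notin> B" "y \<in> B" "z \<in> B" "fst ` B \<subseteq> HM_parts x y z"
    "\<And>s. s \<in> HM_parts x y z \<Longrightarrow> card {v \<in> B. fst v = s} = k s"
    "card B = (\<Sum>s\<in>HM_parts x y z. k s)"
    "int (card (HM x B)) \<le> M_max p n k"
proof -
  note V = triangle_V[OF T]
  have "\<exists>X\<in>PF. {y, z} \<subseteq> X \<and> X \<inter> {x} = {}"
    by (rule valid_avoiding) (use T V K_pos in \<open>auto simp: triangle_def\<close>)
  then obtain A where A: "A \<in> PF" "y \<in> A" "z \<in> A" "x \<notin> A" by auto
  let ?Q = "HM_parts x y z"
  define B where "B = {v \<in> A. fst v \<in> ?Q}"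
  have Q: "?Q \<subseteq> {1..p}" using V part_range unfolding HM_parts_def by auto
  have t: "fst x \<in> ?Q \<longleftrightarrow> k (fst x) > 1"
    using T same_part_k[of x y] same_part_k[of x z] unfolding HM_parts_def triangle_def by auto
  have yz: "y \<in> B" "z \<in> B" using A by (auto simp: B_def HM_parts_def)
  have fin: "finite B" using PF_finite[OF A(1)] by (auto simp: B_def)
  have "card {y, z} \<le> card B" using yz fin by (intro card_mono) auto
  then have c2: "card B \<ge> 2" using T by (simp add: triangle_def)
  have "int (card (HM x B)) \<le> M_max p n k"
    using card_HM_le_max[OF V(1) A(1,4) Q t] c2 by (simp add: B_def)
  moreover have "card {v \<in> B. fst v = s} = k s" if s: "s \<in> ?Q" for s
  proof -
    have "{v \<in> B. fst v = s} = {v \<in> A. fst v \<in> {s}}" using s by (auto simp: B_def)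
    then show ?thesis using card_restrict_part[OF A(1), of "{s}"] Q s by auto
  qed
  moreover have "card B = (\<Sum>s\<in>?Q. k s)" using card_restrict_part[OF A(1) Q] by (simp add: B_def)
  moreover have "B \<subseteq> V" "x \<notin> B" "fst ` B \<subseteq> ?Q" using A PF_subset[OF A(1)] by (auto simp: B_def)
  ultimately show ?thesis using that[of B] yz fin by blast
qed

lemma two_of_full:
  assumes T: "triangle x y z" and c: "(\<Sum>s\<in>HM_parts x y z. k s) = 2"
  shows "int (card (two_of x y z)) \<le> M_max p n k"
proof -
  obtain B where B: "finite B" "y \<in> B" "z \<in> B" "card B = (\<Sum>s\<in>HM_parts x y z. k s)"
    "int (card (HM x B)) \<le> M_max p n k"
    using T by (rule triangle_HM)
  have "{y, z} = B" using B c T by (intro card_seteq) (auto simp: triangle_def)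
  then have "two_of x y z \<subseteq> HM x B" by (auto simp: two_of_def HM_def)
  then have "card (two_of x y z) \<le> card (HM x B)" by (rule card_mono[OF finite_HM])
  then show ?thesis using B by linarith
qed

text \<open>With a single further element u in \<open>B\<close> the two differences are known
  exactly. Gain and loss may then even be equal, so an estimate that wastes a constant factor would
  not do.\<close>

lemma two_of_swap:
  assumes "B = {y, z, u}" "int (card (HM x B)) \<le> M_max p n k"
    and "card (upd {y, z} {x, u}) \<le> card (upd {x, u} {y, z})"
  shows "int (card (two_of x y z)) \<le> M_max p n k"
proof -
  have "two_of x y z - HM x B \<subseteq> upd {y, z} {x, u}"
    using assms(1) by (auto simp: two_of_def HM_def upd_def)
  then have "card (two_of x y z - HM x B) \<le> card (upd {y, z} {x, u})"
    by (rule card_mono[OF finite_upd])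
  also note assms(3)
  also have "upd {x, u} {y, z} \<subseteq> HM x B - two_of x y z"
    using assms(1) by (auto simp: two_of_def HM_def upd_def)
  then have "card (upd {x, u} {y, z}) \<le> card (HM x B - two_of x y z)"
    by (intro card_mono finite_Diff finite_HM)
  finally have "card (two_of x y z) \<le> card (HM x B)" by (rule card_le_by_diff[OF finite_HM finite_two_of])
  then show ?thesis using assms(2) by linarith
qed

text \<open>The probability that a uniformly random set of \<open>PF\<close> contains two given
  elements, one of part s and one of part r, distinct if s = r.\<close>

definition pw :: "nat \<Rightarrow> nat \<Rightarrow> real" where
  "pw s r = (if s = r then (k s / n s) * ((real (k s) - 1) / (real (n s) - 1))
             else (k s / n s) * (k r / n r))"

lemma w_pair:
  assumes "valid {a, b}" "a \<noteq> b"
  shows "w {a, b} = w {} * pw (fst a) (fst b)"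
proof -
  have V: "a \<in> V" "b \<in> V" using valid_V[OF assms(1)] by auto
  show ?thesis
  proof (cases "fst a = fst b")
    case True
    then have "k (fst a) \<ge> 2" using same_part_k[OF assms] by simp
    then show ?thesis using w_pair_same(1)[OF V assms(2) refl] True by (simp add: pw_def)
  next
    case False
    then show ?thesis using w_pair_diff(1)[OF V False] by (simp add: pw_def)
  qed
qed

text \<open>
The Hilton-Milner family gains the sets that contain x and just one further element of B other
than y, z, and it loses at most the sets containing y and z. The slack 5/4 absorbs the factor 7/8
of \<open>card_upd_ge\<close>. Parts with k s = 1 contribute pw s s = 0, so including fst x in the sum is
harmless even if B has no element there.
\<close>

lemma two_of_gain:
  assumes T: "triangle x y z"
    and gain: "5 * pw (fst y) (fst z) \<le> 4 * ((\<Sum>s\<in>{fst x, fst y, fst z}. k s * pw (fst x) s)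
      - pw (fst x) (fst y) - pw (fst x) (fst z))"
  shows "int (card (two_of x y z)) \<le> M_max p n k"
proof -
  let ?Q = "HM_parts x y z"
  obtain B where B: "B \<subseteq> V" "finite B" "x \<notin> B" "y \<in> B" "z \<in> B" "fst ` B \<subseteq> ?Q"
    "\<And>s. s \<in> ?Q \<Longrightarrow> card {v \<in> B. fst v = s} = k s"
    "card B = (\<Sum>s\<in>?Q. k s)" "int (card (HM x B)) \<le> M_max p n k"
    by (rule triangle_HM[OF T]) blast
  note V = triangle_V[OF T]
  have ne: "x \<noteq> y" "x \<noteq> z" "y \<noteq> z" and v: "valid {x, y}" "valid {x, z}" "valid {y, z}"
    using T by (auto simp: triangle_def)
  have finQ: "finite ?Q" by (simp add: HM_parts_def)
  have vx: "valid {x, u}" if u: "u \<in> B" for u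
  proof (rule valid_pairI)
    show "x \<in> V" "u \<in> V" "x \<noteq> u" using V B u by auto
    assume "fst x = fst u"
    then have "fst x \<in> ?Q" using B(6) u by auto
    then show "k (fst x) > 1" using same_part_k[OF v(1) ne(1)] same_part_k[OF v(2) ne(2)]
      by (auto simp: HM_parts_def split: if_splits)
  qed
  have "(\<Sum>u\<in>B. w {x, u}) = (\<Sum>s\<in>?Q. \<Sum>u | u \<in> B \<and> fst u = s. w {x, u})"
    using sum.group[OF B(2) finQ B(6), of "\<lambda>u. w {x, u}"] by simp
  also have "\<dots> = (\<Sum>s\<in>?Q. \<Sum>u | u \<in> B \<and> fst u = s. w {} * pw (fst x) s)"
  proof (intro sum.cong refl)
    fix s u assume "u \<in> {u. u \<in> B \<and> fst u = s}"
    then have u: "u \<in> B" "fst u = s" by auto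
    then have "x \<noteq> u" using B(3) by blast
    then show "w {x, u} = w {} * pw (fst x) s" using w_pair[OF vx[OF u(1)]] u(2) by simp
  qed
  also have "\<dots> = (\<Sum>s\<in>?Q. w {} * (k s * pw (fst x) s))"
    using B(7) by (intro sum.cong) auto
  also have "\<dots> = w {} * (\<Sum>s\<in>?Q. k s * pw (fst x) s)" by (simp add: sum_distrib_left)
  also have "(\<Sum>s\<in>?Q. k s * pw (fst x) s) = (\<Sum>s\<in>{fst x, fst y, fst z}. k s * pw (fst x) s)"
  proof (rule sum.mono_neutral_left)
    show "\<forall>i\<in>{fst x, fst y, fst z} - ?Q. real (k i) * pw (fst x) i = 0"
    proof
      fix i assume "i \<in> {fst x, fst y, fst z} - ?Q"
      then have "i = fst x" "\<not> k (fst x) > 1" by (auto simp: HM_parts_def split: if_splits)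
      moreover have "k (fst x) \<ge> 1" using k_pos[OF part_range[OF V(1)]] .
      ultimately show "real (k i) * pw (fst x) i = 0" by (simp add: pw_def)
    qed
  qed (auto simp: HM_parts_def)
  finally have sumB: "(\<Sum>u\<in>B. w {x, u}) = w {} * (\<Sum>s\<in>{fst x, fst y, fst z}. k s * pw (fst x) s)" .
  define C where "C = B - {y, z}"
  have "(\<Sum>u\<in>B. w {x, u}) = (\<Sum>u\<in>C. w {x, u}) + (\<Sum>u\<in>{y, z}. w {x, u})"
    unfolding C_def using B by (intro sum.subset_diff) auto
  then have sumC: "(\<Sum>u\<in>C. w {x, u}) = w {} * ((\<Sum>s\<in>{fst x, fst y, fst z}. k s * pw (fst x) s)
      - pw (fst x) (fst y) - pw (fst x) (fst z))"
    using sumB w_pair[OF v(1) ne(1)] w_pair[OF v(2) ne(2)] ne(3) by (simp add: algebra_simps)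
  have loss: "card (two_of x y z - HM x B) \<le> card (up {y, z})"
    using B by (intro card_mono finite_upd) (auto simp: two_of_def HM_def upd_def)
  have cardB: "card B \<le> K"
  proof -
    have "?Q \<subseteq> {1..p}" using V part_range unfolding HM_parts_def by auto
    then show ?thesis unfolding B(8) K_def by (intro sum_mono2) auto
  qed
  have U: "(\<Union>u\<in>C. upd {x, u} (B - {u})) \<subseteq> HM x B - two_of x y z"
    using B(4,5) unfolding C_def HM_def two_of_def upd_def by auto
  have "card (\<Union>u\<in>C. upd {x, u} (B - {u})) = (\<Sum>u\<in>C. card (upd {x, u} (B - {u})))"
  proof (rule card_UN_disjoint)
    show "\<forall>i\<in>C. \<forall>j\<in>C. i \<noteq> j \<longrightarrow> upd {x, i} (B - {i}) \<inter> upd {x, j} (B - {j}) = {}"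
      unfolding C_def upd_def by auto
  qed (use B finite_upd in \<open>auto simp: C_def\<close>)
  then have g1: "(\<Sum>u\<in>C. card (upd {x, u} (B - {u}))) \<le> card (HM x B - two_of x y z)"
    using card_mono[OF finite_Diff[OF finite_HM] U] by simp
  have "7 * (\<Sum>u\<in>C. w {x, u}) = (\<Sum>u\<in>C. 7 * w {x, u})" by (rule sum_distrib_left)
  also have "\<dots> \<le> (\<Sum>u\<in>C. 8 * real (card (upd {x, u} (B - {u}))))"
  proof (intro sum_mono card_upd_ge)
    fix u assume "u \<in> C"
    show "B - {u} \<subseteq> V" using B by auto
    show "card (B - {u}) \<le> K" using cardB card_mono[OF B(2), of "B - {u}"] by auto
    show "(B - {u}) \<inter> {x, u} = {}" using B by auto
  qed
  also have "\<dots> = 8 * real (\<Sum>u\<in>C. card (upd {x, u} (B - {u})))" by (simp add: sum_distrib_left)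
  also have "\<dots> \<le> 8 * real (card (HM x B - two_of x y z))" using g1 by (intro mult_left_mono of_nat_mono) auto
  finally have g2: "7 * (\<Sum>u\<in>C. w {x, u}) \<le> 8 * real (card (HM x B - two_of x y z))" .
  have "5 * w {y, z} = w {} * (5 * pw (fst y) (fst z))" using w_pair[OF v(3) ne(3)] by simp
  also have "\<dots> \<le> w {} * (4 * ((\<Sum>s\<in>{fst x, fst y, fst z}. k s * pw (fst x) s)
      - pw (fst x) (fst y) - pw (fst x) (fst z)))"
    using gain by (intro mult_left_mono) auto
  also have "\<dots> = 4 * (\<Sum>u\<in>C. w {x, u})" using sumC by (simp only: mult_ac)
  finally have "5 * w {y, z} \<le> 4 * (\<Sum>u\<in>C. w {x, u})" .
  moreover have "0 \<le> (\<Sum>u\<in>C. w {x, u})" by (intro sum_nonneg) simp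
  ultimately have "w {y, z} \<le> real (card (HM x B - two_of x y z))" using g2 by linarith
  then have "card (two_of x y z - HM x B) \<le> card (HM x B - two_of x y z)"
    using loss by (simp add: w_def)
  then have "card (two_of x y z) \<le> card (HM x B)" by (rule card_le_by_diff[OF finite_HM finite_two_of])
  then show ?thesis using B(9) by linarith
qed

lemma pw_same_ge:
  assumes "s \<in> {1..p}"
  shows "(real (k s) - 1) * (k s / n s) ^ 2 \<le> k s * pw s s"
proof -
  have n: "real (n s) > 1" using n_ge_K[OF assms] K_pos by linarith
  have k: "real (k s) \<ge> 1" using k_pos[OF assms] by simp
  have "(real (k s) - 1) / real (n s) \<le> (real (k s) - 1) / (real (n s) - 1)"
    using n k by (intro divide_left_mono) auto
  then have "(k s * (k s / n s)) * ((real (k s) - 1) / real (n s)) \<le> (k s * (k s / n s)) * ((real (k s) - 1) / (real (n s) - 1))"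
    by (intro mult_left_mono) auto
  then show ?thesis by (simp add: pw_def power2_eq_square mult_ac)
qed

text \<open>A second element of the same part has density (k - 1) / (n - 1) instead of k / n. For k
  at most 3 this is smaller by a factor of about 2/3, which yields the 4/5 that
  \<open>two_of_gain\<close> demands when one pair must outweigh the lost one.\<close>

lemma pw_same_le:
  assumes "s \<in> {1..p}"
  shows "pw s s \<le> (k s / n s) ^ 2" "k s \<le> 3 \<Longrightarrow> 5 * pw s s \<le> 4 * (k s / n s) ^ 2"
proof -
  have n: "real (n s) \<ge> 8 * real (k s)" using n_ge_K[OF assms] k_le_K[OF assms] by linarith
  have k: "real (k s) \<ge> 1" using k_pos[OF assms] by simp
  have "(real (k s) - 1) / (real (n s) - 1) \<le> k s / n s"
    using n k by (simp add: field_simps)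
  then have "(k s / n s) * ((real (k s) - 1) / (real (n s) - 1)) \<le> (k s / n s) * (k s / n s)"
    by (intro mult_left_mono) auto
  then show "pw s s \<le> (k s / n s) ^ 2"
    by (simp add: pw_def power2_eq_square)
  assume "k s \<le> 3"
  then have k3: "real (k s) \<le> 3" by simp
  have "5 * (a - 1) * c \<le> 4 * a * (c - 1)" if "a \<le> 3" "1 \<le> a" "8 * a \<le> c" for a c :: real
  proof -
    have "a * c \<le> 3 * c" using that by (intro mult_right_mono) auto
    then have "a * c + 4 * a \<le> 5 * c" using that by linarith
    then show ?thesis by (simp add: algebra_simps)
  qed
  from this[OF k3 k n]
  have "5 * (real (k s) - 1) * real (n s) \<le> 4 * real (k s) * (real (n s) - 1)" .
  then have "5 * ((real (k s) - 1) / (real (n s) - 1)) \<le> 4 * (k s / n s)"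
    using n k by (simp add: field_simps)
  then have "(k s / n s) * (5 * ((real (k s) - 1) / (real (n s) - 1))) \<le> (k s / n s) * (4 * (k s / n s))"
    by (intro mult_left_mono) auto
  then show "5 * pw s s \<le> 4 * (k s / n s) ^ 2"
    by (simp add: pw_def power2_eq_square mult_ac)
qed

section \<open>Triangles by the number of parts that they occupy\<close>

lemma card_fibre_pair:
  assumes "a \<noteq> b"
  shows "card ({a, b} `` {s}) = (if fst a = s then 1 else 0) + (if fst b = s then 1 else 0)"
proof -
  have "{a, b} `` {s} = snd ` {v \<in> {a, b}. fst v = s}" by force
  moreover have "inj_on snd {v \<in> {a, b}. fst v = s}" by (auto simp: inj_on_def prod_eq_iff)
  moreover have "{v \<in> {a, b}. fst v = s} = (if fst a = s then {a} else {}) \<union> (if fst b = s then {b} else {})"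
    by auto
  ultimately show ?thesis using assms by (simp add: card_image)
qed

lemma card_upd_pairs:
  assumes "valid {a, b}" "a \<noteq> b" "c \<in> V" "d \<in> V" "c \<noteq> d" "{a, b} \<inter> {c, d} = {}"
  shows "card (upd {a, b} {c, d}) = (\<Prod>s\<in>{1..p}.
    (n s - ((if fst a = s then 1 else 0) + (if fst b = s then 1 else 0))
         - ((if fst c = s then 1 else 0) + (if fst d = s then 1 else 0)))
    choose (k s - ((if fst a = s then 1 else 0) + (if fst b = s then 1 else 0))))"
proof -
  have V: "{a, b} \<subseteq> V" by (rule valid_V[OF assms(1)])
  show ?thesis
    using card_upd[OF V _ assms(6)] valid_iff[OF V] assms(1,3,4)
    unfolding card_fibre_pair[OF assms(2)] card_fibre_pair[OF assms(5)] by simp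
qed

text \<open>All pairs in part t weigh the same: k t - 2 of them are gained and one is lost. The
  slack 5/4 is available from k t = 4 on; for k t = 3 the exact counts agree, and for k t = 2
  nothing is lost.\<close>

lemma two_of_one_part:
  assumes T: "triangle x y z" and p: "fst y = fst x" "fst z = fst x"
  shows "int (card (two_of x y z)) \<le> M_max p n k"
proof -
  define t where "t = fst x"
  have ne: "x \<noteq> y" "x \<noteq> z" "y \<noteq> z" and v: "valid {x, y}" "valid {x, z}" "valid {y, z}"
    using T by (auto simp: triangle_def)
  have kt: "k t \<ge> 2" using same_part_k[OF v(1) ne(1)] p by (simp add: t_def)
  have Q: "HM_parts x y z = {t}" using p kt by (auto simp: HM_parts_def t_def)
  consider "k t = 2" | "k t = 3" | "k t \<ge> 4" using kt by linarith
  then show ?thesis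
  proof cases
    case 1
    then show ?thesis using two_of_full[OF T] Q by simp
  next
    case 2
    obtain B where B: "B \<subseteq> V" "finite B" "x \<notin> B" "y \<in> B" "z \<in> B" "fst ` B \<subseteq> HM_parts x y z"
      "\<And>s. s \<in> HM_parts x y z \<Longrightarrow> card {v \<in> B. fst v = s} = k s"
      "card B = (\<Sum>s\<in>HM_parts x y z. k s)" "int (card (HM x B)) \<le> M_max p n k"
      by (rule triangle_HM[OF T]) blast
    have "card (B - {y, z}) = 1" using B 2 Q ne(3) by (simp add: card_Diff_subset)
    then obtain u where u: "B - {y, z} = {u}" by (auto simp: card_1_singleton_iff)
    then have Bu: "B = {y, z, u}" "u \<noteq> y" "u \<noteq> z" "u \<in> B" using B by auto
    have pu: "fst u = t" using Bu(4) B(6) Q by auto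
    have xu: "x \<noteq> u" using Bu B by auto
    have vxu: "valid {x, u}"
      using triangle_V[OF T] B(1) Bu(4) xu kt by (intro valid_pairI) (auto simp: t_def)
    have "card (upd {y, z} {x, u}) = card (upd {x, u} {y, z})"
      using card_upd_pairs[OF v(3) ne(3) _ _ xu] card_upd_pairs[OF vxu xu _ _ ne(3)]
        triangle_V[OF T] B(1) Bu ne xu p pu by (auto simp: t_def)
    then show ?thesis using two_of_swap[OF Bu(1) B(9)] by simp
  next
    case 3
    have nn: "0 \<le> pw t t"
    proof -
      have "real (n t) \<ge> 1" using n_ge_K[of t] K_pos part_range[OF triangle_V(1)[OF T]] unfolding t_def by fastforce
      then show ?thesis using kt by (simp add: pw_def)
    qed
    have "5 * pw t t \<le> 4 * (real (k t) * pw t t - pw t t - pw t t)"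
    proof -
      have "4 * pw t t \<le> real (k t) * pw t t" using 3 nn by (intro mult_right_mono) auto
      moreover have "5 * a \<le> 4 * (b - a - a)" if "4 * a \<le> b" "0 \<le> a" for a b :: real
        using that by argo
      ultimately show ?thesis using nn by blast
    qed
    then show ?thesis using two_of_gain[OF T] p by (simp add: t_def)
  qed
qed

text \<open>The centre is put into the denser part, where the pairs through it weigh most: at z,
  losing a pair of part t, or at x, losing a mixed pair. Only for k t = 2 and k r = 1 is z chosen
  regardless of density, because then \<open>B\<close> consists of x and y.\<close>

lemma two_of_two_parts:
  assumes T: "triangle x y z" and p: "fst y = fst x" "fst z \<noteq> fst x"
  shows "int (card (two_of x y z)) \<le> M_max p n k"
proof -
  define t where "t = fst x"
  define r where "r = fst z"
  define \<alpha> where "\<alpha> = real (k t) / real (n t)"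
  define \<gamma> where "\<gamma> = real (k r) / real (n r)"
  note V = triangle_V[OF T]
  have tr: "t \<in> {1..p}" "r \<in> {1..p}" using part_range V by (auto simp: t_def r_def)
  have ne: "x \<noteq> y" and v: "valid {x, y}" using T by (auto simp: triangle_def)
  have kt: "k t \<ge> 2" using same_part_k[OF v ne] p by (simp add: t_def)
  have kr: "k r \<ge> 1" using k_pos tr by simp
  have nn: "\<alpha> \<ge> 0" "\<gamma> \<ge> 0" by (auto simp: \<alpha>_def \<gamma>_def)
  have rt: "r \<noteq> t" using p by (simp add: t_def r_def)
  have pwtr: "pw t r = \<alpha> * \<gamma>" "pw r t = \<alpha> * \<gamma>" using rt by (auto simp: pw_def \<alpha>_def \<gamma>_def mult.commute)
  have T': "triangle z x y" using T triangle_commute by blast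
  have two': "two_of z x y = two_of x y z" by (auto simp: two_of_def)
  show ?thesis
  proof (cases "k t = 2 \<and> k r = 1")
    case True
    then have "HM_parts z x y = {t}" using p by (auto simp: HM_parts_def t_def r_def)
    then show ?thesis using two_of_full[OF T'] True two' by simp
  next
    case False
    show ?thesis
    proof (cases "\<gamma> \<ge> \<alpha>")
      case True
      have sq: "\<alpha> ^ 2 \<le> \<alpha> * \<gamma>" "\<alpha> * \<gamma> \<le> \<gamma> ^ 2"
        using True nn by (auto simp: power2_eq_square mult_left_mono mult_right_mono)
      have r1: "(real (k r) - 1) * \<gamma> ^ 2 \<le> k r * pw r r" using pw_same_ge[OF tr(2)] by (simp add: \<gamma>_def)
      have r0: "0 \<le> (real (k r) - 1) * \<gamma> ^ 2" using kr by simp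
      \<comment> \<open>For k t = 2 the other part has k r >= 2 and provides the gain; for k t = 3
        one mixed pair suffices, both times thanks to the 4/5 bound. From k t = 4 on there are two
        mixed pairs.\<close>
      have "5 * pw t t \<le> 4 * ((real (k t) - 2) * (\<alpha> * \<gamma>) + k r * pw r r)"
      proof (cases "k t = 2")
        case two: True
        then have "real (k r) - 1 \<ge> 1" using False kr by simp
        then have "1 * \<gamma> ^ 2 \<le> (real (k r) - 1) * \<gamma> ^ 2" by (intro mult_right_mono) auto
        moreover have "5 * pw t t \<le> 4 * \<alpha> ^ 2" using pw_same_le(2)[OF tr(1)] two by (simp add: \<alpha>_def)
        ultimately show ?thesis using two sq r1 by simp
      next
        case False
        show ?thesis
        proof (cases "k t = 3")
          case True
          then have "5 * pw t t \<le> 4 * \<alpha> ^ 2" using pw_same_le(2)[OF tr(1)] by (simp add: \<alpha>_def)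
          then show ?thesis using True sq r1 r0 by simp
        next
          case f3: False
          have "2 * (\<alpha> * \<gamma>) \<le> (real (k t) - 2) * (\<alpha> * \<gamma>)"
            using nn kt False f3 by (intro mult_right_mono) auto
          moreover have "pw t t \<le> \<alpha> ^ 2" using pw_same_le(1)[OF tr(1)] by (simp add: \<alpha>_def)
          moreover have "0 \<le> \<alpha> * \<gamma>" using nn by simp
          ultimately show ?thesis using sq r1 r0 by argo
        qed
      qed
      then have "5 * pw t t \<le> 4 * ((\<Sum>s\<in>{r, t}. k s * pw r s) - pw r t - pw r t)"
        using rt pwtr by (simp add: algebra_simps)
      then show ?thesis using two_of_gain[OF T'] p two' by (simp add: t_def r_def)
    next
      case less: False
      then have sq: "\<alpha> * \<gamma> \<le> \<alpha> ^ 2" using nn by (simp add: power2_eq_square mult_left_mono)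
      have t1: "(real (k t) - 1) * \<alpha> ^ 2 \<le> k t * pw t t" using pw_same_ge[OF tr(1)] by (simp add: \<alpha>_def)
      have r0: "(real (k r) - 1) * (\<alpha> * \<gamma>) \<ge> 0" using kr nn by simp
      have a0: "0 \<le> \<alpha> * \<gamma>" "0 \<le> \<alpha> ^ 2" using nn by auto
      have "5 * (\<alpha> * \<gamma>) \<le> 4 * ((real (k t) - 1) * pw t t + (real (k r) - 1) * (\<alpha> * \<gamma>))"
      proof (cases "k t = 2")
        case True
        then have "real (k r) - 1 \<ge> 1" using False kr by simp
        then have "1 * (\<alpha> * \<gamma>) \<le> (real (k r) - 1) * (\<alpha> * \<gamma>)" using nn by (intro mult_right_mono) auto
        then show ?thesis using t1 True sq a0 by simp
      next
        case f2: False
        define c where "c = real (k t)"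
        have c: "c \<ge> 3" using f2 kt by (simp add: c_def)
        \<comment> \<open>This is 5 \<alpha>^2 <= 4 (c - 1) \<open>pw t t\<close> with
          \<open>pw t t\<close> replaced by its lower bound (c - 1) \<alpha>^2 / c; it just holds at
          c = 3.\<close>
        have "5 * c \<le> 4 * (c - 1) ^ 2"
        proof -
          have "0 \<le> (c - 3) * (4 * c - 1)" using c by simp
          then show ?thesis by (simp add: power2_eq_square algebra_simps)
        qed
        then have "5 * c * \<alpha> ^ 2 \<le> 4 * (c - 1) ^ 2 * \<alpha> ^ 2" by (intro mult_right_mono) auto
        also have "\<dots> = 4 * (c - 1) * ((c - 1) * \<alpha> ^ 2)" by (simp add: power2_eq_square)
        also have "\<dots> \<le> 4 * (c - 1) * (c * pw t t)"
          using t1 c unfolding c_def by (intro mult_left_mono) auto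
        finally have "c * (5 * \<alpha> ^ 2) \<le> c * (4 * ((c - 1) * pw t t))" by (simp only: mult_ac)
        then have "5 * \<alpha> ^ 2 \<le> 4 * ((c - 1) * pw t t)" using c by simp
        then show ?thesis using sq r0 by (simp add: c_def)
      qed
      then have "5 * pw t r \<le> 4 * ((\<Sum>s\<in>{t, r}. k s * pw t s) - pw t t - pw t r)"
        using rt pwtr by (simp add: algebra_simps)
      then show ?thesis using two_of_gain[OF T] p by (simp add: t_def r_def)
    qed
  qed
qed

text \<open>With x in the densest part, each gained pair in another part weighs at least as much as
  the lost one, and the k pairs inside the part of x count for k - 1 of them by
  \<open>pw_same_ge\<close>. The total is the sum of the three k minus 3, hence at least two lost
  pairs; a sum of 4 would leave only one.\<close>

lemma two_of_three_parts_gain: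
  assumes T: "triangle x y z" and p: "fst x \<noteq> fst y" "fst x \<noteq> fst z" "fst y \<noteq> fst z"
    and k5: "k (fst x) + k (fst y) + k (fst z) \<ge> 5"
    and mx: "k (fst y) / n (fst y) \<le> k (fst x) / n (fst x)" "k (fst z) / n (fst z) \<le> k (fst x) / n (fst x)"
  shows "int (card (two_of x y z)) \<le> M_max p n k"
proof -
  define r t s where "r = fst x" and "t = fst y" and "s = fst z"
  define \<beta> \<alpha> \<gamma> where "\<beta> = real (k r) / real (n r)"
    and "\<alpha> = real (k t) / real (n t)" and "\<gamma> = real (k s) / real (n s)"
  note V = triangle_V[OF T]
  have P: "r \<in> {1..p}" "t \<in> {1..p}" "s \<in> {1..p}" using part_range V by (auto simp: r_def t_def s_def)
  have ne: "r \<noteq> t" "r \<noteq> s" "t \<noteq> s" using p by (auto simp: r_def t_def s_def)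
  have nn: "\<alpha> \<ge> 0" "\<beta> \<ge> 0" "\<gamma> \<ge> 0" by (auto simp: \<alpha>_def \<beta>_def \<gamma>_def)
  have mx': "\<alpha> \<le> \<beta>" "\<gamma> \<le> \<beta>" using mx by (auto simp: \<alpha>_def \<beta>_def \<gamma>_def r_def t_def s_def)
  have k: "real (k r) \<ge> 1" "real (k t) \<ge> 1" "real (k s) \<ge> 1" using k_pos P by auto
  have pws: "pw r t = \<beta> * \<alpha>" "pw r s = \<beta> * \<gamma>" "pw t s = \<alpha> * \<gamma>"
    using ne by (auto simp: pw_def \<alpha>_def \<beta>_def \<gamma>_def)
  have "\<alpha> * \<gamma> \<le> \<beta> ^ 2" using nn mx' by (simp add: power2_eq_square mult_mono)
  then have "(real (k r) - 1) * (\<alpha> * \<gamma>) \<le> (real (k r) - 1) * \<beta> ^ 2" using k by (intro mult_left_mono) auto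
  also have "\<dots> \<le> k r * pw r r" using pw_same_ge[OF P(1)] by (simp add: \<beta>_def)
  finally have 1: "(real (k r) - 1) * (\<alpha> * \<gamma>) \<le> k r * pw r r" .
  have "\<alpha> * \<gamma> \<le> \<beta> * \<alpha>" using nn mx' mult_left_mono[of \<gamma> \<beta> \<alpha>] by (simp add: mult.commute)
  then have 2: "(real (k t) - 1) * (\<alpha> * \<gamma>) \<le> (real (k t) - 1) * (\<beta> * \<alpha>)" using k by (intro mult_left_mono) auto
  have "\<alpha> * \<gamma> \<le> \<beta> * \<gamma>" using nn mx' by (simp add: mult_right_mono)
  then have 3: "(real (k s) - 1) * (\<alpha> * \<gamma>) \<le> (real (k s) - 1) * (\<beta> * \<gamma>)" using k by (intro mult_left_mono) auto
  have "2 \<le> (real (k r) - 1) + (real (k t) - 1) + (real (k s) - 1)"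
    using k5 by (simp add: r_def t_def s_def)
  then have "2 * (\<alpha> * \<gamma>) \<le> ((real (k r) - 1) + (real (k t) - 1) + (real (k s) - 1)) * (\<alpha> * \<gamma>)"
    using nn by (intro mult_right_mono) auto
  then have "2 * (\<alpha> * \<gamma>) \<le> k r * pw r r + (real (k t) - 1) * (\<beta> * \<alpha>) + (real (k s) - 1) * (\<beta> * \<gamma>)"
    using 1 2 3 by (simp only: distrib_right)
  moreover have "0 \<le> \<alpha> * \<gamma>" using nn by simp
  ultimately have "5 * (\<alpha> * \<gamma>) \<le> 4 * (k r * pw r r + (real (k t) - 1) * (\<beta> * \<alpha>) + (real (k s) - 1) * (\<beta> * \<gamma>))"
    by argo
  then have "5 * pw t s \<le> 4 * ((\<Sum>i\<in>{r, t, s}. k i * pw r i) - pw r t - pw r s)"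
    using ne pws by (simp add: algebra_simps)
  then show ?thesis using two_of_gain[OF T] by (simp add: r_def t_def s_def)
qed

text \<open>The further element u lies in the part of y, where exchanging y and u makes the counts
  equal. What differs is one free choice: n - 1 elements in the part of x for the loss, in the part
  of z for the gain. Hence the centre belongs in the smaller of the two parts with k = 1.\<close>

lemma two_of_three_parts_swap:
  assumes T: "triangle x y z" and p: "fst x \<noteq> fst y" "fst x \<noteq> fst z" "fst y \<noteq> fst z"
    and k: "k (fst x) = 1" "k (fst y) = 2" "k (fst z) = 1" and le: "n (fst x) \<le> n (fst z)"
  shows "int (card (two_of x y z)) \<le> M_max p n k"
proof -
  let ?r = "fst x" and ?t = "fst y" and ?s = "fst z"
  note V = triangle_V[OF T]
  have ne: "x \<noteq> y" "x \<noteq> z" "y \<noteq> z" and v: "valid {x, y}" "valid {x, z}" "valid {y, z}"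
    using T by (auto simp: triangle_def)
  have Q: "HM_parts x y z = {?t, ?s}" using k by (auto simp: HM_parts_def)
  obtain B where B: "B \<subseteq> V" "finite B" "x \<notin> B" "y \<in> B" "z \<in> B" "fst ` B \<subseteq> HM_parts x y z"
    "\<And>s. s \<in> HM_parts x y z \<Longrightarrow> card {v \<in> B. fst v = s} = k s"
    "card B = (\<Sum>s\<in>HM_parts x y z. k s)" "int (card (HM x B)) \<le> M_max p n k"
    by (rule triangle_HM[OF T]) blast
  have "card (B - {y, z}) = 1" using B k Q ne(3) p by (simp add: card_Diff_subset)
  then obtain u where u: "B - {y, z} = {u}" by (auto simp: card_1_singleton_iff)
  then have Bu: "B = {y, z, u}" "u \<noteq> y" "u \<noteq> z" "u \<in> B" using B by auto
  have "fst u \<noteq> ?s"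
  proof
    assume "fst u = ?s"
    then have "card {z, u} \<le> card {v \<in> B. fst v = ?s}"
      using B(2) Bu B(5) by (intro card_mono) auto
    also have "\<dots> = 1" using B(7)[of ?s] Q k by simp
    finally show False using Bu(3) by simp
  qed
  then have pu: "fst u = ?t" using Bu(4) B(6) Q by auto
  have xu: "x \<noteq> u" using Bu B by auto
  have uV: "u \<in> V" using B(1) Bu(4) by auto
  have vxu: "valid {x, u}" using V(1) uV xu p pu by (intro valid_pairI) auto
  define f where "f i = ((n i - ((if ?t = i then 1 else 0) + (if ?s = i then 1 else 0))
         - ((if ?r = i then 1 else 0) + (if ?t = i then 1 else 0)))
    choose (k i - ((if ?t = i then 1 else 0) + (if ?s = i then 1 else 0))))" for i
  define g where "g i = ((n i - ((if ?r = i then 1 else 0) + (if ?t = i then 1 else 0))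
         - ((if ?t = i then 1 else 0) + (if ?s = i then 1 else 0)))
    choose (k i - ((if ?r = i then 1 else 0) + (if ?t = i then 1 else 0))))" for i
  have P: "?r \<in> {1..p}" "?s \<in> {1..p}" using part_range V by auto
  have split: "(\<Prod>i\<in>{1..p}. h i) = h ?r * (h ?s * (\<Prod>i\<in>{1..p} - {?r} - {?s}. h i))" for h :: "nat \<Rightarrow> nat"
    using P p prod.remove[of "{1..p}" ?r h] prod.remove[of "{1..p} - {?r}" ?s h] by simp
  have "card (upd {y, z} {x, u}) = (\<Prod>i\<in>{1..p}. f i)"
    unfolding f_def using card_upd_pairs[OF v(3) ne(3) V(1) uV xu] ne Bu pu by auto
  also have "\<dots> = f ?r * (f ?s * (\<Prod>i\<in>{1..p} - {?r} - {?s}. f i))" by (rule split)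
  also have "\<dots> = f ?r * (f ?s * (\<Prod>i\<in>{1..p} - {?r} - {?s}. g i))"
  proof -
    have "(\<Prod>i\<in>{1..p} - {?r} - {?s}. f i) = (\<Prod>i\<in>{1..p} - {?r} - {?s}. g i)"
      by (rule prod.cong) (auto simp: f_def g_def)
    then show ?thesis by simp
  qed
  also have "\<dots> \<le> g ?r * (g ?s * (\<Prod>i\<in>{1..p} - {?r} - {?s}. g i))"
  proof -
    have "f ?r = n ?r - 1" "f ?s = 1" "g ?r = 1" "g ?s = n ?s - 1"
      using p k by (auto simp: f_def g_def)
    moreover have "n ?r - 1 \<le> n ?s - 1" using le by (rule diff_le_mono)
    ultimately show ?thesis by (simp add: mult_right_mono)
  qed
  also have "\<dots> = (\<Prod>i\<in>{1..p}. g i)" by (rule split[symmetric])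
  also have "\<dots> = card (upd {x, u} {y, z})"
    unfolding g_def using card_upd_pairs[OF vxu xu V(2,3) ne(3)] ne Bu pu by auto
  finally show ?thesis by (rule two_of_swap[OF Bu(1) B(9)])
qed

section \<open>The bound\<close>

lemma two_of_le_max:
  assumes T: "triangle x y z"
  shows "int (card (two_of x y z)) \<le> M_max p n k"
proof -
  have perm: "triangle y x z" "triangle x z y" "triangle z x y" "triangle y z x" "triangle z y x"
    using T triangle_commute by blast+
  have two: "two_of y x z = two_of x y z" "two_of x z y = two_of x y z" "two_of z x y = two_of x y z"
    "two_of y z x = two_of x y z" "two_of z y x = two_of x y z"
    by (auto simp: two_of_def)
  consider "fst y = fst x" "fst z = fst x" | "fst y = fst x" "fst z \<noteq> fst x"
    | "fst z = fst x" "fst y \<noteq> fst x" | "fst z = fst y" "fst x \<noteq> fst y"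
    | "fst x \<noteq> fst y" "fst x \<noteq> fst z" "fst y \<noteq> fst z"
    by metis
  then show ?thesis
  proof cases
    case 1
    then show ?thesis using two_of_one_part[OF T] by blast
  next
    case 2
    then show ?thesis using two_of_two_parts[OF T] by blast
  next
    case 3
    then show ?thesis using two_of_two_parts[OF perm(2)] two by simp
  next
    case 4
    then show ?thesis using two_of_two_parts[OF perm(4)] two by simp
  next
    case ne: 5
    note V = triangle_V[OF T]
    have k: "k (fst x) \<ge> 1" "k (fst y) \<ge> 1" "k (fst z) \<ge> 1" using k_pos part_range V by blast+
    let ?q = "\<lambda>v. real (k (fst v)) / real (n (fst v))"
    consider "k (fst x) + k (fst y) + k (fst z) \<ge> 5"
      | "k (fst x) = 1" "k (fst y) = 1" "k (fst z) = 1"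
      | "k (fst x) = 2" "k (fst y) = 1" "k (fst z) = 1"
      | "k (fst x) = 1" "k (fst y) = 2" "k (fst z) = 1"
      | "k (fst x) = 1" "k (fst y) = 1" "k (fst z) = 2"
      using k by linarith
    then show ?thesis
    proof cases
      case 1
      consider "?q y \<le> ?q x" "?q z \<le> ?q x" | "?q x \<le> ?q y" "?q z \<le> ?q y" | "?q x \<le> ?q z" "?q y \<le> ?q z"
        by linarith
      then show ?thesis
      proof cases
        case a: 1
        show ?thesis using two_of_three_parts_gain[OF T ne] 1 a by simp
      next
        case a: 2
        show ?thesis using two_of_three_parts_gain[OF perm(1)] ne 1 a two by simp
      next
        case a: 3
        show ?thesis using two_of_three_parts_gain[OF perm(3)] ne 1 a two by simp
      qed
    next
      case 2
      then show ?thesis using two_of_full[OF T] ne by (simp add: HM_parts_def)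
    next
      case 3
      show ?thesis
      proof (cases "n (fst y) \<le> n (fst z)")
        case True
        then show ?thesis using two_of_three_parts_swap[OF perm(1)] ne 3 two by simp
      next
        case False
        then show ?thesis using two_of_three_parts_swap[OF perm(3)] ne 3 two by simp
      qed
    next
      case 4
      show ?thesis
      proof (cases "n (fst x) \<le> n (fst z)")
        case True
        then show ?thesis using two_of_three_parts_swap[OF T ne] 4 by simp
      next
        case False
        then show ?thesis using two_of_three_parts_swap[OF perm(5)] ne 4 two by simp
      qed
    next
      case 5
      show ?thesis
      proof (cases "n (fst x) \<le> n (fst y)")
        case True
        then show ?thesis using two_of_three_parts_swap[OF perm(2)] ne 5 two by simp
      next
        case False
        then show ?thesis using two_of_three_parts_swap[OF perm(4)] ne 5 two by simp
      qed
    qed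
  qed
qed

lemma nontrivial_family_le_max:
  assumes "G \<subseteq> PF" "\<And>A B. A \<in> G \<Longrightarrow> B \<in> G \<Longrightarrow> A \<inter> B \<noteq> {}" "\<And>v. v \<in> V \<Longrightarrow> \<exists>A\<in>G. v \<notin> A"
  shows "int (card G) \<le> M_max p n k"
proof -
  define N where "N = {G. G \<subseteq> PF \<and> (\<forall>A\<in>G. \<forall>B\<in>G. A \<inter> B \<noteq> {}) \<and> (\<forall>v\<in>V. \<exists>A\<in>G. v \<notin> A)}"
  have "finite N" by (rule finite_subset[of _ "Pow PF"]) (auto simp: N_def finite_PF)
  have GN: "G \<in> N" using assms by (simp add: N_def)
  have "finite (card ` N)" "card ` N \<noteq> {}" using \<open>finite N\<close> GN by auto
  then have "Max (card ` N) \<in> card ` N" by (rule Max_in)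
  then obtain F where F: "F \<in> N" "card F = Max (card ` N)" by auto
  have max: "card G' \<le> card F" if "G' \<in> N" for G'
    unfolding F(2) using that \<open>finite N\<close> by (intro Max_ge) auto
  interpret intersecting_family p n k K F
  proof
    show "F \<subseteq> PF" "\<And>A B. A \<in> F \<Longrightarrow> B \<in> F \<Longrightarrow> A \<inter> B \<noteq> {}" "\<And>v. v \<in> V \<Longrightarrow> \<exists>A\<in>F. v \<notin> A"
      using F(1) unfolding N_def by blast+
    fix X assume X: "X \<in> PF" "\<And>A. A \<in> F \<Longrightarrow> X \<inter> A \<noteq> {}"
    \<comment> \<open>Membership of \<open>insert X F\<close> in \<open>N\<close> also requires X to
      meet itself.\<close>
    have "X \<noteq> {}" using card_PF_elem[OF X(1)] K_pos by auto
    show "X \<in> F"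
    proof (rule ccontr)
      assume "X \<notin> F"
      have "insert X F \<in> N" using F(1) X \<open>X \<noteq> {}\<close> unfolding N_def by (simp add: Int_commute)
      then have "card (insert X F) \<le> card F" by (rule max)
      moreover have "finite F" using F(1) finite_PF finite_subset unfolding N_def by blast
      ultimately show False using \<open>X \<notin> F\<close> by simp
    qed
  qed
  have "int (card F) \<le> M_max p n k"
  proof (rule ccontr)
    assume "\<not> ?thesis"
    then have "int (card F) > M_max p n k" by simp
    from large_family_two_of[OF this] obtain x y z where T: "triangle x y z" and "F \<subseteq> two_of x y z"
      unfolding triangle_def by blast
    then have "card F \<le> card (two_of x y z)" by (intro card_mono finite_two_of)
    with two_of_le_max[OF T] \<open>\<not> ?thesis\<close> show False by linarith
  qed
  with max[OF GN] show ?thesis by linarith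
qed

end

section \<open>From families of functions to sets of pairs\<close>

theorem theorem1p1:
  fixes p :: nat and k :: "nat \<Rightarrow> nat"
  assumes "p \<ge> 1" and "\<forall>s\<in>{1..p}. k s \<ge> 1"
  shows "\<exists>n0::nat. \<forall>n :: nat \<Rightarrow> nat. (\<forall>s\<in>{1..p}. n s \<ge> n0) \<longrightarrow>
           (\<forall>\<F>. \<F> \<subseteq> prod_family p n k \<and> nontrivially_intersecting p n \<F>
                 \<longrightarrow> int (card \<F>) \<le> M_max p n k)"
proof -
  define K where "K = (\<Sum>s\<in>{1..p}. k s)"
  have "int (card \<F>) \<le> M_max p n k"
    if n: "\<forall>s\<in>{1..p}. n s \<ge> 8 * K ^ (K + 6)" and sub: "\<F> \<subseteq> prod_family p n k"
      and nt: "nontrivially_intersecting p n \<F>" for n :: "nat \<Rightarrow> nat" and \<F>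
  proof -
    interpret multipart p n k K
      by unfold_locales (use assms n K_def in auto)
    \<comment> \<open>The graph on {1..p}. Members are empty outside these parts, so nothing is
      forgotten and the map is injective on the family.\<close>
    let ?f = "\<lambda>A :: nat \<Rightarrow> nat set. Sigma {1..p} A"
    have fibre: "?f A `` {s} = A s" if "s \<in> {1..p}" for A s using that by auto
    have "inj_on ?f \<F>"
    proof (rule inj_onI)
      fix A B assume AB: "A \<in> \<F>" "B \<in> \<F>" "?f A = ?f B"
      show "A = B"
      proof
        fix s
        show "A s = B s"
        proof (cases "s \<in> {1..p}")
          case True
          then show ?thesis using fibre AB(3) by metis
        next
          case False
          then show ?thesis using AB(1,2) sub unfolding prod_family_def by auto
        qed
      qed
    qed
    then have "card (?f ` \<F>) = card \<F>" by (rule card_image)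
    moreover have "int (card (?f ` \<F>)) \<le> M_max p n k"
    proof (rule nontrivial_family_le_max)
      show "?f ` \<F> \<subseteq> PF"
      proof clarify
        fix A assume "A \<in> \<F>"
        then have A: "A s \<subseteq> {1..n s}" "card (A s) = k s" if "s \<in> {1..p}" for s
          using that sub unfolding prod_family_def by blast+
        have "?f A \<subseteq> V" using A(1) unfolding V_def by blast
        then show "?f A \<in> PF" unfolding PF_def using fibre A(2) by auto
      qed
      show "C \<inter> D \<noteq> {}" if CD: "C \<in> ?f ` \<F>" "D \<in> ?f ` \<F>" for C D
      proof -
        obtain A B where AB: "A \<in> \<F>" "B \<in> \<F>" "C = ?f A" "D = ?f B" using CD by blast
        then obtain s where "s \<in> {1..p}" "A s \<inter> B s \<noteq> {}"
          using nt unfolding nontrivially_intersecting_def intersecting_def by blast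
        then show ?thesis using AB(3,4) by blast
      qed
      show "\<exists>C\<in>?f ` \<F>. v \<notin> C" if v: "v \<in> V" for v
      proof -
        obtain s i where si: "v = (s, i)" "s \<in> {1..p}" "i \<in> {1..n s}" using v unfolding V_def by blast
        then obtain A where "A \<in> \<F>" "i \<notin> A s"
          using nt unfolding nontrivially_intersecting_def trivially_intersecting_def by blast
        then show ?thesis using si by blast
      qed
    qed
    ultimately show ?thesis by simp
  qed
  then show ?thesis by blast
qed

end
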